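(* Let $\mu,\epsilon>0$ be constants, let $\Omega_\Gamma^h\subset\mathbb{R}^3$ be a local patch of side length $\ell_h>0$, let $I_\Gamma^h=[t_n-\Delta t_\Gamma,t_n]$ with $\Delta t_\Gamma>0$, and let $\Gamma$ be a time-independent interface with unit normal $\hat{\mathbf n}$ whose part $\Omega_\Gamma^h\cap\Gamma$ has positive surface area. Let $\mathbf J_s$ and $\rho_s$ be given (known) surface current and surface charge densities on $\Gamma$. Let $k\ge 0$ be an integer, $$V=\big\{\mathbf v\in[P^k(\Omega_\Gamma^h\times I_\Gamma^h)]^3:\ \nabla\cdot\mathbf v=0\big\},\qquad W=V,$$ and, for $c_p>0$, consider the problem of minimizing over $(\mathbf D_H,\mathbf D_E)\in V\times W$ the quadratic functional $$\begin{aligned} J(\mathbf D_H,\mathbf D_E)=\ &\tfrac{\ell_h}{2}\langle\mu\,\partial_t\mathbf D_H+\nabla\times\mathbf D_E,\ \mu\,\partial_t\mathbf D_H+\nabla\times\mathbf D_E\rangle\\ &+\tfrac{\ell_h}{2}\langle\epsilon\,\partial_t\mathbf D_E-\nabla\times\mathbf D_H,\ \epsilon\,\partial_t\mathbf D_E-\nabla\times\mathbf D_H\rangle\\ &+\tfrac{c_p}{2}\langle\hat{\mathbf n}\times\mathbf D_H-\mathbf J_s,\ \hat{\mathbf n}\times\mathbf D_H-\mathbf J_s\rangle_\Gamma+\tfrac{c_p}{2}\langle\hat{\mathbf n}\cdot\mathbf D_H,\ \hat{\mathbf n}\cdot\mathbf D_H\rangle_\Gamma\\ &+\tfrac{c_p}{2}\langle\hat{\mathbf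 n}\times\mathbf D_E,\ \hat{\mathbf n}\times\mathbf D_E\rangle_\Gamma+\tfrac{c_p}{2}\big\langle\hat{\mathbf n}\cdot\mathbf D_E-\tfrac{\rho_s}{\epsilon},\ \hat{\mathbf n}\cdot\mathbf D_E-\tfrac{\rho_s}{\epsilon}\big\rangle_\Gamma . \end{aligned}$$ Then there exists a positive constant $\tilde c=\frac{c_p}{\ell_h}$ (that is, a choice of $c_p>0$ for the given $\ell_h$) for which $J$ has a unique global minimizer in $V\times W$.
   Context: The local patch $\Omega_\Gamma^h$ is an axis-aligned cube of side $\ell_h$ centred at a point of the embedded boundary (interface) $\Gamma$. The inner products are $$\langle\mathbf v,\mathbf w\rangle=\int_{I_\Gamma^h}\int_{\Omega_\Gamma^h}\mathbf v\cdot\mathbf w\,dV\,dt,\qquad \langle\mathbf v,\mathbf w\rangle_\Gamma=\int_{I_\Gamma^h}\int_{\Omega_\Gamma^h\cap\Gamma}\mathbf v\cdot\mathbf w\,dS\,dt,$$ with the ordinary product of scalars used for scalar-valued entries. $P^k(\Omega_\Gamma^h\times I_\Gamma^h)$ denotes the polynomials of degree at most $k$ in the space-time variables $(\mathbf x,t)$; $\nabla\cdot$ and $\nabla\times$ act on the space variables only. The data $\mathbf J_s,\rho_s$ are assumed square-integrable on $(\Omega_\Gamma^h\cap\Gamma)\times I_\Gamma^h$, so that $J$ is finite. *)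

theory Defs
  imports "HOL-Analysis.Analysis"
begin

section \<open>Surface area in three-space\<close>

text \<open>
  The surface element is the two-dimensional Hausdorff measure, with the factor \<open>pi / 4\<close> that makes
  the unit square have area one; on a \<open>C\<^sup>1\<close> surface it is the usual surface area.
  Covering sets are required to be bounded because the library's diameter is unspecified
  on unbounded sets.
\<close>

definition hausdorff2_pre :: "real \<Rightarrow> (real^3) set \<Rightarrow> ennreal" where
  "hausdorff2_pre \<delta> A =
     (INF C \<in> {C :: nat \<Rightarrow> (real^3) set. A \<subseteq> (\<Union>i. C i) \<and> (\<forall>i. bounded (C i) \<and> diameter (C i) \<le> \<delta>)}.
        \<Sum>i. ennreal (pi / 4 * (diameter (C i))\<^sup>2))"

definition hausdorff2_outer :: "(real^3) set \<Rightarrow> ennreal" where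
  "hausdorff2_outer A = (SUP \<delta>\<in>{0<..}. hausdorff2_pre \<delta> A)"

definition surface_area :: "(real^3) measure" where
  "surface_area = measure_of UNIV (sets borel) hausdorff2_outer"

text \<open>
  Since \<open>measure_of\<close> yields the zero measure when its argument is not countably additive, we
  verify that the Hausdorff outer measure is countably additive on the Borel sets.
\<close>

lemma hausdorff2_pre_empty: "0 < \<delta> \<Longrightarrow> hausdorff2_pre \<delta> {} = 0"
proof -
  assume "0 < \<delta>"
  then have "hausdorff2_pre \<delta> {} \<le> (\<Sum>i::nat. ennreal (pi / 4 * (diameter ({} :: (real^3) set))\<^sup>2))"
    unfolding hausdorff2_pre_def by (intro INF_lower) auto
  then show ?thesis by simp
qed

lemma hausdorff2_pre_mono: "A \<subseteq> B \<Longrightarrow> hausdorff2_pre \<delta> A \<le> hausdorff2_pre \<delta> B"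
  unfolding hausdorff2_pre_def by (rule INF_superset_mono) auto

lemma hausdorff2_pre_antimono: "\<delta> \<le> \<delta>' \<Longrightarrow> hausdorff2_pre \<delta>' A \<le> hausdorff2_pre \<delta> A"
  unfolding hausdorff2_pre_def by (rule INF_superset_mono) (auto intro: order_trans)

lemma hausdorff2_pre_subadd: "hausdorff2_pre \<delta> (\<Union>n. A n) \<le> (\<Sum>n::nat. hausdorff2_pre \<delta> (A n))"
proof (rule ennreal_le_epsilon)
  fix e :: real
  let ?f = "\<lambda>S. ennreal (pi / 4 * (diameter S)\<^sup>2)"
  assume "0 < e" "(\<Sum>n. hausdorff2_pre \<delta> (A n)) < top"
  then have *: "hausdorff2_pre \<delta> (A n) < hausdorff2_pre \<delta> (A n) + e * (1/2)^Suc n" for n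
    by (auto simp add: less_top dest!: ennreal_suminf_lessD)
  have "\<exists>C. A n \<subseteq> (\<Union>i::nat. C i) \<and> (\<forall>i. bounded (C i) \<and> diameter (C i) \<le> \<delta>) \<and>
      (\<Sum>i. ?f (C i)) \<le> hausdorff2_pre \<delta> (A n) + e * (1/2)^Suc n" for n
    using *[of n] unfolding hausdorff2_pre_def[of \<delta> "A n"] INF_less_iff
    by (force intro: less_imp_le simp flip: hausdorff2_pre_def)
  then obtain B where B: "\<And>n. A n \<subseteq> (\<Union>i::nat. B n i)"
      "\<And>n i. bounded (B n i) \<and> diameter (B n i) \<le> \<delta>"
      "\<And>n. (\<Sum>i. ?f (B n i)) \<le> hausdorff2_pre \<delta> (A n) + e * (1/2)^Suc n"
    by metis
  define C where "C = case_prod B o prod_decode"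
  have A_C: "(\<Union>i. A i) \<subseteq> (\<Union>i. C i)"
    using B(1) by (auto simp add: C_def subset_eq) (metis prod.case prod_encode_inverse)
  have "hausdorff2_pre \<delta> (\<Union>n. A n) \<le> (\<Sum>i. ?f (C i))"
    unfolding hausdorff2_pre_def using A_C B(2) by (intro INF_lower) (auto simp: C_def split_def)
  also have "\<dots> = (\<Sum>n. \<Sum>i. ?f (B n i))"
    unfolding C_def comp_def
    by (intro suminf_ennreal_2dimen) auto
  also have "\<dots> \<le> (\<Sum>n. hausdorff2_pre \<delta> (A n) + e * (1/2) ^ Suc n)"
    by (intro suminf_le suminf_nonneg allI B(3)) auto
  also have "\<dots> = (\<Sum>n. hausdorff2_pre \<delta> (A n)) + (\<Sum>n. ennreal e * ennreal ((1/2) ^ Suc n))"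
    using \<open>0 < e\<close> by (subst suminf_add[symmetric])
      (auto simp del: ennreal_suminf_cmult simp add: ennreal_mult[symmetric])
  also have "\<dots> = (\<Sum>n. hausdorff2_pre \<delta> (A n)) + e"
    unfolding ennreal_suminf_cmult
    by (subst suminf_ennreal_eq[OF zero_le_power power_half_series]) auto
  finally show "hausdorff2_pre \<delta> (\<Union>n. A n) \<le> (\<Sum>n. hausdorff2_pre \<delta> (A n)) + e" .
qed

lemma hausdorff2_outer_empty: "hausdorff2_outer {} = 0"
proof -
  have "hausdorff2_outer {} = (SUP \<delta>\<in>{0::real<..}. 0)"
    unfolding hausdorff2_outer_def by (rule SUP_cong) (auto simp: hausdorff2_pre_empty)
  then show ?thesis by simp
qed

lemma hausdorff2_outer_mono: "A \<subseteq> B \<Longrightarrow> hausdorff2_outer A \<le> hausdorff2_outer B"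
  unfolding hausdorff2_outer_def by (intro SUP_mono') (rule hausdorff2_pre_mono)

lemma hausdorff2_outer_subadd: "hausdorff2_outer (\<Union>n. A n) \<le> (\<Sum>n::nat. hausdorff2_outer (A n))"
  unfolding hausdorff2_outer_def[of "\<Union>n. A n"]
proof (rule SUP_least)
  fix \<delta> :: real assume "\<delta> \<in> {0<..}"
  then have "(\<Sum>n. hausdorff2_pre \<delta> (A n)) \<le> (\<Sum>n. hausdorff2_outer (A n))"
    unfolding hausdorff2_outer_def by (intro suminf_le SUP_upper) auto
  with hausdorff2_pre_subadd show "hausdorff2_pre \<delta> (\<Union>n. A n) \<le> (\<Sum>n. hausdorff2_outer (A n))"
    by (rule order_trans)
qed

lemma hausdorff2_outer_space: "outer_measure_space (Pow UNIV) hausdorff2_outer"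
  unfolding outer_measure_space_def positive_def increasing_def countably_subadditive_def
  by (auto simp: hausdorff2_outer_empty hausdorff2_outer_mono hausdorff2_outer_subadd)

lemma hausdorff2_outer_Un_le: "hausdorff2_outer (A \<union> B) \<le> hausdorff2_outer A + hausdorff2_outer B"
proof -
  interpret sigma_algebra UNIV "Pow UNIV :: (real^3) set set" by (rule sigma_algebra_Pow)
  have "subadditive (Pow UNIV) hausdorff2_outer"
    using hausdorff2_outer_space unfolding outer_measure_space_def
    by (intro countably_subadditive_subadditive) auto
  from subadditiveD[OF this, of A "B - A"] hausdorff2_outer_mono[of "B - A" B]
  show ?thesis by (auto intro: order_trans add_left_mono)
qed

lemma hausdorff2_pre_separated:
  assumes sep: "\<And>x y. x \<in> A \<Longrightarrow> y \<in> B \<Longrightarrow> \<delta> < dist x y" and "0 < \<delta>"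
  shows "hausdorff2_pre \<delta> A + hausdorff2_pre \<delta> B \<le> hausdorff2_pre \<delta> (A \<union> B)"
  unfolding hausdorff2_pre_def[of \<delta> "A \<union> B"]
proof (rule INF_greatest)
  let ?f = "\<lambda>S. ennreal (pi / 4 * (diameter S)\<^sup>2)"
  fix C :: "nat \<Rightarrow> (real^3) set"
  assume "C \<in> {C. A \<union> B \<subseteq> (\<Union>i. C i) \<and> (\<forall>i. bounded (C i) \<and> diameter (C i) \<le> \<delta>)}"
  then have C: "A \<union> B \<subseteq> (\<Union>i. C i)" "\<And>i. bounded (C i)" "\<And>i. diameter (C i) \<le> \<delta>" by auto
  define R where "R X i = (if C i \<inter> X = {} then {} else C i)" for X i
  have R: "hausdorff2_pre \<delta> X \<le> (\<Sum>i. ?f (R X i))" if "X \<subseteq> A \<union> B" for X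
    unfolding hausdorff2_pre_def
  proof (rule INF_lower, safe)
    fix x assume "x \<in> X"
    moreover from this that C(1) obtain i where "x \<in> C i" by blast
    ultimately show "x \<in> (\<Union>i. R X i)" by (auto simp: R_def)
  qed (use C \<open>0 < \<delta>\<close> in \<open>auto simp: R_def\<close>)
  have "C i \<inter> A = {} \<or> C i \<inter> B = {}" for i
    using sep diameter_bounded_bound[OF C(2)] C(3) by (meson disjoint_iff not_le order_trans)
  then have "?f (R A i) + ?f (R B i) \<le> ?f (C i)" for i
    by (auto simp: R_def)
  then have "(\<Sum>i. ?f (R A i)) + (\<Sum>i. ?f (R B i)) \<le> (\<Sum>i. ?f (C i))"
    by (subst suminf_add) (auto intro!: suminf_le)
  then show "hausdorff2_pre \<delta> A + hausdorff2_pre \<delta> B \<le> (\<Sum>i. ?f (C i))"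
    using R[of A] R[of B] by (meson add_mono order_trans sup_ge1 sup_ge2)
qed

lemma hausdorff2_outer_separated:
  assumes "0 < d" and sep: "\<And>x y. x \<in> A \<Longrightarrow> y \<in> B \<Longrightarrow> d \<le> dist x y"
  shows "hausdorff2_outer A + hausdorff2_outer B \<le> hausdorff2_outer (A \<union> B)"
proof -
  have le: "hausdorff2_pre \<delta> A + hausdorff2_pre \<delta>' B \<le> hausdorff2_outer (A \<union> B)"
    if "0 < \<delta>" "0 < \<delta>'" for \<delta> \<delta>'
  proof -
    define \<eta> where "\<eta> = min (d / 2) (min \<delta> \<delta>')"
    have \<eta>: "0 < \<eta>" "\<eta> < d" "\<eta> \<le> \<delta>" "\<eta> \<le> \<delta>'" using that \<open>0 < d\<close> by (auto simp: \<eta>_def)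
    have "hausdorff2_pre \<delta> A + hausdorff2_pre \<delta>' B \<le> hausdorff2_pre \<eta> A + hausdorff2_pre \<eta> B"
      using \<eta> by (intro add_mono hausdorff2_pre_antimono)
    also have "\<dots> \<le> hausdorff2_pre \<eta> (A \<union> B)"
      using \<eta> sep by (intro hausdorff2_pre_separated) fastforce+
    also have "\<dots> \<le> hausdorff2_outer (A \<union> B)"
      unfolding hausdorff2_outer_def using \<eta> by (intro SUP_upper) auto
    finally show ?thesis .
  qed
  have ne: "{0::real<..} \<noteq> {}" by auto
  have "hausdorff2_outer A + hausdorff2_outer B
      = (SUP \<delta>'\<in>{0<..}. SUP \<delta>\<in>{0<..}. hausdorff2_pre \<delta> A + hausdorff2_pre \<delta>' B)"
    unfolding hausdorff2_outer_def
    by (simp add: ennreal_SUP_add_left[OF ne] ennreal_SUP_add_right[OF ne])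
  also have "\<dots> \<le> hausdorff2_outer (A \<union> B)"
    using le by (intro SUP_least) auto
  finally show ?thesis .
qed

lemma closed_in_lambda_system:
  assumes "closed F"
  shows "F \<in> lambda_system UNIV (Pow UNIV) hausdorff2_outer"
proof (cases "F = {}")
  case True
  then show ?thesis by (auto simp: lambda_system_def hausdorff2_outer_empty)
next
  case False
  let ?H = hausdorff2_outer
  have "?H (A \<inter> F) + ?H (A - F) \<le> ?H A" for A
  proof (cases "?H A = \<infinity>")
    case fin: False
    define D where "D n = {x \<in> A. 1 / real (Suc n) \<le> infdist x F}" for n
    define R where "R n = {x \<in> A. 1 / real (Suc (Suc n)) \<le> infdist x F \<and> infdist x F < 1 / real (Suc n)}" for n
    have mono: "1 / real (Suc n) \<le> 1 / real (Suc m)" if "m \<le> n" for m n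
      using that by (simp add: field_simps)
    have near: "\<exists>m\<ge>n. x \<in> R m" if "x \<in> A" "x \<notin> F" "x \<notin> D n" for x n
    proof -
      have pos: "0 < infdist x F"
        using that(2) infdist_pos_not_in_closed[OF assms False] by auto
      obtain N where "1 / real (Suc N) \<le> infdist x F"
        using pos by (metis inverse_eq_divide less_eq_real_def reals_Archimedean)
      define m where "m = (LEAST m. 1 / real (Suc m) \<le> infdist x F)"
      have m: "1 / real (Suc m) \<le> infdist x F"
        unfolding m_def by (rule LeastI) fact
      have "n < m" using that m mono[of m n] by (force simp: D_def not_less[symmetric])
      then obtain k where k: "m = Suc k" by (cases m) auto
      have "\<not> 1 / real (Suc k) \<le> infdist x F"
        using not_less_Least[of k "\<lambda>m. 1 / real (Suc m) \<le> infdist x F"] k m_def by auto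
      then have "x \<in> R k" using m k that(1) by (auto simp: R_def)
      with \<open>n < m\<close> k show ?thesis by (intro exI[of _ k]) auto
    qed
    have sepR: "?H (\<Union>j<n. R (2 * j + c)) \<ge> (\<Sum>j<n. ?H (R (2 * j + c)))" for n c
    proof (induction n)
      case 0
      then show ?case by simp
    next
      case (Suc n)
      let ?U = "\<Union>j<n. R (2 * j + c)"
      have "?H ?U + ?H (R (2 * n + c)) \<le> ?H (?U \<union> R (2 * n + c))"
      proof (cases "n = 0")
        case True
        then show ?thesis by (simp add: hausdorff2_outer_empty)
      next
        case False
        show ?thesis
        proof (rule hausdorff2_outer_separated)
          show "0 < 1 / real (2 * n + c) - 1 / real (Suc (2 * n + c))"
            using False by (simp add: divide_strict_left_mono)
        next
          fix x y assume x: "x \<in> ?U" and y: "y \<in> R (2 * n + c)"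
          obtain j where j: "j < n" "x \<in> R (2 * j + c)" using x by auto
          have "1 / real (2 * n + c) \<le> 1 / real (Suc (Suc (2 * j + c)))"
            using j mono[of "Suc (2 * j + c)" "2 * n + c - 1"] by simp
          also have "\<dots> \<le> infdist x F" using j by (simp add: R_def)
          finally have "1 / real (2 * n + c) \<le> infdist x F" .
          moreover have "infdist y F < 1 / real (Suc (2 * n + c))" using y by (simp add: R_def)
          ultimately show "1 / real (2 * n + c) - 1 / real (Suc (2 * n + c)) \<le> dist x y"
            using infdist_triangle[of x F y] by simp
        qed
      qed
      moreover have "?U \<union> R (2 * n + c) = (\<Union>j<Suc n. R (2 * j + c))"
        by (auto simp: less_Suc_eq)
      ultimately show ?case using add_right_mono[OF Suc.IH, of "?H (R (2 * n + c))"]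
        by (simp only: sum.lessThan_Suc)
    qed
    have part: "(\<Sum>j<n. ?H (R (2 * j + c))) \<le> ?H A" for n c
      by (rule order_trans[OF sepR hausdorff2_outer_mono]) (auto simp: R_def)
    have "(\<Sum>i<n. ?H (R i)) \<le> 2 * ?H A" for n
    proof -
      have "(\<Sum>i<n. ?H (R i)) \<le> (\<Sum>i<2 * n. ?H (R i))"
        by (rule sum_mono2) auto
      also have "\<dots> = (\<Sum>j<n. ?H (R (2 * j))) + (\<Sum>j<n. ?H (R (2 * j + 1)))"
        by (induction n) (auto simp: ac_simps)
      also have "\<dots> \<le> ?H A + ?H A"
        using part[of 0 n] part[of 1 n] by (intro add_mono) auto
      finally show ?thesis by (simp add: mult_2)
    qed
    then have "(\<Sum>i. ?H (R i)) \<le> 2 * ?H A"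
      by (intro suminf_le_const) auto
    also have "\<dots> < \<infinity>" using fin by (simp add: ennreal_mult_less_top less_top)
    finally have Rfin: "(\<Sum>i. ?H (R i)) \<noteq> \<infinity>" by simp
    define r where "r i = enn2real (?H (R i))" for i
    have r: "?H (R i) = ennreal (r i)" "0 \<le> r i" for i
      using ennreal_suminf_lessD[of "\<lambda>i. ?H (R i)" top i] Rfin by (auto simp: r_def less_top)
    have summ: "summable r"
      using Rfin r by (intro summable_suminf_not_top) auto
    have bound: "?H (A \<inter> F) + ?H (A - F) \<le> ?H A + ennreal (\<Sum>m. r (m + n))" for n
    proof -
      have "A - F \<subseteq> D n \<union> (\<Union>m. R (m + n))"
        using near by (fastforce dest: le_Suc_ex simp: add.commute)
      then have "?H (A - F) \<le> ?H (D n \<union> (\<Union>m. R (m + n)))"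
        by (rule hausdorff2_outer_mono)
      also have "\<dots> \<le> ?H (D n) + ?H (\<Union>m. R (m + n))" by (rule hausdorff2_outer_Un_le)
      also have "\<dots> \<le> ?H (D n) + (\<Sum>m. ?H (R (m + n)))"
        by (intro add_left_mono hausdorff2_outer_subadd)
      also have "(\<Sum>m. ?H (R (m + n))) = ennreal (\<Sum>m. r (m + n))"
        using summ r by (simp add: suminf_ennreal2 summable_ignore_initial_segment)
      finally have "?H (A \<inter> F) + ?H (A - F) \<le> (?H (A \<inter> F) + ?H (D n)) + ennreal (\<Sum>m. r (m + n))"
        by (simp add: add.assoc add_left_mono)
      also have "?H (A \<inter> F) + ?H (D n) \<le> ?H ((A \<inter> F) \<union> D n)"
      proof (rule hausdorff2_outer_separated)
        show "0 < 1 / real (Suc n)" by simp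
        show "1 / real (Suc n) \<le> dist x y" if "x \<in> A \<inter> F" "y \<in> D n" for x y
          using that infdist_le[of x F y] by (auto simp: D_def dist_commute)
      qed
      also have "\<dots> \<le> ?H A" by (rule hausdorff2_outer_mono) (auto simp: D_def)
      finally show ?thesis by (simp add: add_right_mono)
    qed
    have "(\<lambda>n. \<Sum>m. r (m + n)) \<longlonglongrightarrow> 0"
      using suminf_exist_split2[OF summ] .
    then have "(\<lambda>n. ?H A + ennreal (\<Sum>m. r (m + n))) \<longlonglongrightarrow> ?H A + ennreal 0"
      by (intro tendsto_add tendsto_const tendsto_ennrealI)
    from LIMSEQ_le_const[OF this] bound show ?thesis by simp
  qed simp
  then have "?H (A \<inter> F) + ?H (A - F) = ?H A" for A
    by (metis (no_types) Int_Diff_Un hausdorff2_outer_Un_le order_antisym)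
  then show ?thesis
    by (auto simp: lambda_system_def Int_commute Diff_eq)
qed

lemma hausdorff2_measure_space: "measure_space UNIV (sets borel) hausdorff2_outer"
proof -
  interpret sigma_algebra UNIV "Pow UNIV :: (real^3) set set" by (rule sigma_algebra_Pow)
  let ?L = "lambda_system UNIV (Pow UNIV) hausdorff2_outer"
  have L: "measure_space UNIV ?L hausdorff2_outer"
    by (rule caratheodory_lemma[OF hausdorff2_outer_space])
  then interpret L: sigma_algebra UNIV ?L by (simp add: measure_space_def)
  have "sigma_sets UNIV (Collect closed) \<subseteq> ?L"
    by (intro L.sigma_sets_subset) (auto intro: closed_in_lambda_system simp del: Pow_UNIV)
  then have "sets borel \<subseteq> ?L"
    by (subst borel_eq_closed, subst sets_measure_of) auto
  with L show ?thesis
    unfolding measure_space_def positive_def countably_additive_def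
    using sets.sigma_algebra_axioms[of "borel :: (real^3) measure"] by (auto simp del: Pow_UNIV)
qed

lemma sets_surface_area [simp, measurable_cong]: "sets surface_area = sets borel"
  unfolding surface_area_def using sets.sets_measure_of_eq[of "borel :: (real^3) measure"] by simp

lemma space_surface_area [simp]: "space surface_area = UNIV"
  by (simp add: surface_area_def)

lemma emeasure_surface_area: "A \<in> sets borel \<Longrightarrow> emeasure surface_area A = hausdorff2_outer A"
  using hausdorff2_measure_space unfolding surface_area_def measure_space_def
  by (intro emeasure_measure_of_sigma) auto


section \<open>Surfaces\<close>

text \<open>
  Embedded \<open>C\<^sup>1\<close> surfaces, as local zero sets of \<open>C\<^sup>1\<close> functions \<open>\<phi>\<close> with nonvanishing
  gradient \<open>g\<close>.
\<close>

definition C1_surface :: "(real^3) set \<Rightarrow> bool" where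
  "C1_surface \<Gamma> \<longleftrightarrow>
     (\<forall>p\<in>\<Gamma>. \<exists>U \<phi> g. open U \<and> p \<in> U \<and>
        (\<forall>x\<in>U. (\<phi> has_derivative (\<lambda>h. g x \<bullet> h)) (at x)) \<and> continuous_on U g \<and> (\<forall>x\<in>U. g x \<noteq> 0) \<and>
        \<Gamma> \<inter> U = {x \<in> U. \<phi> x = (0::real)})"

definition tangent_vectors :: "(real^3) set \<Rightarrow> real^3 \<Rightarrow> (real^3) set" where
  "tangent_vectors \<Gamma> p =
     {v. \<exists>\<gamma>. (\<forall>s::real. \<gamma> s \<in> \<Gamma>) \<and> \<gamma> 0 = p \<and> (\<gamma> has_vector_derivative v) (at 0)}"

text \<open>The normal is only constrained on the surface; its continuity makes the surface oriented.\<close>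

definition unit_normal_field :: "(real^3) set \<Rightarrow> (real^3 \<Rightarrow> real^3) \<Rightarrow> bool" where
  "unit_normal_field \<Gamma> n \<longleftrightarrow>
     continuous_on \<Gamma> n \<and> (\<forall>p\<in>\<Gamma>. norm (n p) = 1 \<and> (\<forall>v\<in>tangent_vectors \<Gamma> p. n p \<bullet> v = 0))"


section \<open>Space-time fields\<close>

text \<open>Fields take the space variable first and the time variable second.\<close>

type_synonym scalar_field = "real^3 \<Rightarrow> real \<Rightarrow> real"
type_synonym vector_field = "real^3 \<Rightarrow> real \<Rightarrow> real^3"

definition partial_space :: "3 \<Rightarrow> scalar_field \<Rightarrow> scalar_field" where
  "partial_space i f x t = deriv (\<lambda>s. f (x + s *\<^sub>R axis i 1) t) 0"

definition divergence :: "vector_field \<Rightarrow> scalar_field" where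
  "divergence v x t = (\<Sum>i\<in>UNIV. partial_space i (\<lambda>y s. v y s $ i) x t)"

definition curl :: "vector_field \<Rightarrow> vector_field" where
  "curl v x t = (let d = (\<lambda>i j. partial_space i (\<lambda>y s. v y s $ j) x t) in
     vector [d 2 3 - d 3 2, d 3 1 - d 1 3, d 1 2 - d 2 1])"

definition time_deriv :: "vector_field \<Rightarrow> vector_field" where
  "time_deriv v x t = vector_derivative (\<lambda>s. v x s) (at t)"

text \<open>The closed axis-aligned cube with centre \<open>c\<close> and side length \<open>l\<close>.\<close>

definition cube :: "real^3 \<Rightarrow> real \<Rightarrow> (real^3) set" where
  "cube c l = {x. \<forall>i. \<bar>x $ i - c $ i\<bar> \<le> l / 2}"

text \<open>
  Polynomials of total degree at most \<open>k\<close> in the four space-time variables. They are kept as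
  functions on all of space-time; as a cube times a nondegenerate interval has interior points,
  such a polynomial is determined by its restriction to it.
\<close>

definition poly_space :: "nat \<Rightarrow> scalar_field set" where
  "poly_space k =
     {p. \<exists>a :: nat \<Rightarrow> nat \<Rightarrow> nat \<Rightarrow> nat \<Rightarrow> real. \<forall>x t.
        p x t = (\<Sum>(i, j, l, m) \<in> {(i, j, l, m). i + j + l + m \<le> k}.
                   a i j l m * (x $ 1) ^ i * (x $ 2) ^ j * (x $ 3) ^ l * t ^ m)}"

lemma finite_exponents: "finite {(i, j, l, m). i + j + l + m \<le> (k::nat)}"
  by (rule finite_subset[of _ "{..k} \<times> {..k} \<times> {..k} \<times> {..k}"]) auto

definition div_free_poly_space :: "nat \<Rightarrow> (real^3) set \<Rightarrow> real set \<Rightarrow> vector_field set" where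
  "div_free_poly_space k \<Omega> I =
     {v. (\<forall>i. (\<lambda>x t. v x t $ i) \<in> poly_space k) \<and> (\<forall>x\<in>\<Omega>. \<forall>t\<in>I. divergence v x t = 0)}"


section \<open>Inner products and the functional\<close>

definition inner_vol ::
  "(real^3) set \<Rightarrow> real set \<Rightarrow> (real^3 \<Rightarrow> real \<Rightarrow> 'a::real_inner) \<Rightarrow> (real^3 \<Rightarrow> real \<Rightarrow> 'a) \<Rightarrow> real" where
  "inner_vol \<Omega> I v w = (LINT t:I|lborel. (LINT x:\<Omega>|lborel. v x t \<bullet> w x t))"

definition inner_surf ::
  "(real^3) set \<Rightarrow> real set \<Rightarrow> (real^3 \<Rightarrow> real \<Rightarrow> 'a::real_inner) \<Rightarrow> (real^3 \<Rightarrow> real \<Rightarrow> 'a) \<Rightarrow> real" where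
  "inner_surf S I v w = (LINT t:I|lborel. (LINT x:S|surface_area. v x t \<bullet> w x t))"

text \<open>
  Square integrability with respect to surface area times Lebesgue measure on \<open>S \<times> I\<close>. The measure
  \<open>surface_area\<close> is not sigma-finite on all of space, so it is restricted to \<open>S\<close> before the product
  is formed.
\<close>

definition square_integrable_surf ::
  "(real^3) set \<Rightarrow> real set \<Rightarrow> (real^3 \<Rightarrow> real \<Rightarrow> 'a::euclidean_space) \<Rightarrow> bool" where
  "square_integrable_surf S I f \<longleftrightarrow>
     (let M = restrict_space surface_area S \<Otimes>\<^sub>M restrict_space lborel I in
        (\<lambda>(x, t). f x t) \<in> borel_measurable M \<and> integrable M (\<lambda>(x, t). (norm (f x t))\<^sup>2))"

definition functional_J ::
  "real \<Rightarrow> real \<Rightarrow> real \<Rightarrow> (real^3) set \<Rightarrow> real set \<Rightarrow> (real^3) set \<Rightarrow> (real^3 \<Rightarrow> real^3) \<Rightarrow>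
   vector_field \<Rightarrow> scalar_field \<Rightarrow> real \<Rightarrow> vector_field \<times> vector_field \<Rightarrow> real" where
  "functional_J \<mu> \<epsilon> l \<Omega> I \<Gamma> n J\<^sub>s \<rho>\<^sub>s c\<^sub>p = (\<lambda>(D\<^sub>H, D\<^sub>E).
     (let F = (\<lambda>x t. \<mu> *\<^sub>R time_deriv D\<^sub>H x t + curl D\<^sub>E x t);
          G = (\<lambda>x t. \<epsilon> *\<^sub>R time_deriv D\<^sub>E x t - curl D\<^sub>H x t);
          tH = (\<lambda>x t. cross3 (n x) (D\<^sub>H x t) - J\<^sub>s x t);
          nH = (\<lambda>x t. n x \<bullet> D\<^sub>H x t);
          tE = (\<lambda>x t. cross3 (n x) (D\<^sub>E x t));
          nE = (\<lambda>x t. n x \<bullet> D\<^sub>E x t - \<rho>\<^sub>s x t / \<epsilon>);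
          S = \<Omega> \<inter> \<Gamma>
      in l / 2 * inner_vol \<Omega> I F F + l / 2 * inner_vol \<Omega> I G G
         + c\<^sub>p / 2 * inner_surf S I tH tH + c\<^sub>p / 2 * inner_surf S I nH nH
         + c\<^sub>p / 2 * inner_surf S I tE tE + c\<^sub>p / 2 * inner_surf S I nE nE))"

end

theory Submission
  imports Defs "HOL-Library.Function_Algebras"
begin

text \<open>
  The functional is a weighted sum of squared \<open>L\<^sup>2\<close>-norms of affine residuals on a finite-dimensional
  space, so it has exactly one minimizer as soon as its quadratic part is definite. Definiteness holds for every
  \<open>c\<^sub>p > 0\<close>. If the quadratic part vanishes at \<open>(H, E)\<close>, both fields vanish on the surface, because
  \<open>\<bar>n \<times> v\<bar>\<^sup>2 + (n \<bullet> v)\<^sup>2 = \<bar>v\<bar>\<^sup>2\<close>, and solve the homogeneous divergence-free Maxwell system in the patch.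
  On the surface the tangential and time derivatives then vanish, so that with \<open>g\<close> a normal vector
  \<open>\<partial>\<^sub>i v\<^sub>j = g\<^sub>i w\<^sub>j\<close>, and the equations reduce to \<open>g \<times> w = 0\<close> and \<open>g \<bullet> w = 0\<close>, that is \<open>w = 0\<close>.
  Hence the first derivatives of the fields vanish on the surface as well. They satisfy the same system and have
  lower degree, so induction on the degree shows that they are zero; the fields are then constant, and zero.
\<close>

section \<open>Quadratic functionals on finite-dimensional spaces\<close>

text \<open>Two gaps lie between a vanishing quadratic part and the pointwise argument. First, the
  residuals vanish only almost everywhere, for volume or surface area times Lebesgue measure.
  Continuity upgrades this at points all of whose neighbourhoods have positive measure. For the
  Hausdorff measure on the surface this requires a lower bound on the area of arbitrarily small C1
  pieces. Second, differentiating the equations requires open sets. The centre \<open>c\<close> of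
  the cube lies on the surface, so the surface passes through the interior of the patch, and the
  argument is localized to a ball around \<open>c\<close> and the open time interval.

  The surface times the time axis is noncharacteristic only for the system with the divergence
  constraints: the curl equations alone give \<open>g \<times> w = 0\<close> and leave the component
  of \<open>w\<close> along \<open>g\<close> free. For polynomials the induction on the degree takes
  the place of Holmgren's uniqueness theorem.\<close>

instantiation "fun" :: (type, real_vector) real_vector
begin

definition scaleR_fun :: "real \<Rightarrow> ('a \<Rightarrow> 'b) \<Rightarrow> 'a \<Rightarrow> 'b"
  where "scaleR_fun r f = (\<lambda>x. r *\<^sub>R f x)"

instance
  by standard (simp_all add: scaleR_fun_def fun_eq_iff algebra_simps)

end

lemma scaleR_fun_apply [simp]: "(r *\<^sub>R f) x = r *\<^sub>R f x"
  by (simp add: scaleR_fun_def)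

lemma sum_fun_apply: "(\<Sum>i\<in>A. f i) x = (\<Sum>i\<in>A. f i x)"
  by (induction A rule: infinite_finite_induct) auto

text \<open>All laws are relative to \<open>S\<close>: \<open>deriv\<close> and the integral return
  default values on bad arguments, so the forms used later are bilinear on polynomial fields but not
  on arbitrary functions. Linearity in the second argument follows from symmetry.\<close>

definition psd_form_on :: "'a::real_vector set \<Rightarrow> ('a \<Rightarrow> 'a \<Rightarrow> real) \<Rightarrow> bool" where
  "psd_form_on S a \<longleftrightarrow>
     (\<forall>x\<in>S. \<forall>y\<in>S. a x y = a y x) \<and> (\<forall>x\<in>S. 0 \<le> a x x) \<and>
     (\<forall>x\<in>S. \<forall>y\<in>S. \<forall>z\<in>S. a (x + y) z = a x z + a y z) \<and>
     (\<forall>x\<in>S. \<forall>z\<in>S. \<forall>r. a (r *\<^sub>R x) z = r * a x z)"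

definition linear_form_on :: "'a::real_vector set \<Rightarrow> ('a \<Rightarrow> real) \<Rightarrow> bool" where
  "linear_form_on S L \<longleftrightarrow>
     (\<forall>x\<in>S. \<forall>y\<in>S. L (x + y) = L x + L y) \<and> (\<forall>x\<in>S. \<forall>r. L (r *\<^sub>R x) = r * L x)"

text \<open>The form \<open>a\<close> is exposed and the affine part hidden because uniqueness of
  the minimizer depends on \<open>a\<close> alone. The factor 2 matches the expansion of a squared
  norm.\<close>

definition quadratic_on :: "'a::real_vector set \<Rightarrow> ('a \<Rightarrow> 'a \<Rightarrow> real) \<Rightarrow> ('a \<Rightarrow> real) \<Rightarrow> bool" where
  "quadratic_on S a J \<longleftrightarrow> psd_form_on S a \<and>
     (\<exists>L C. linear_form_on S L \<and> (\<forall>x\<in>S. J x = a x x - 2 * L x + C))"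

lemma psd_form_onD:
  assumes "psd_form_on S a"
  shows "\<And>x y. x \<in> S \<Longrightarrow> y \<in> S \<Longrightarrow> a x y = a y x"
    and "\<And>x. x \<in> S \<Longrightarrow> 0 \<le> a x x"
    and "\<And>x y z. x \<in> S \<Longrightarrow> y \<in> S \<Longrightarrow> z \<in> S \<Longrightarrow> a (x + y) z = a x z + a y z"
    and "\<And>x z r. x \<in> S \<Longrightarrow> z \<in> S \<Longrightarrow> a (r *\<^sub>R x) z = r * a x z"
    and "\<And>x y z. x \<in> S \<Longrightarrow> y \<in> S \<Longrightarrow> z \<in> S \<Longrightarrow> subspace S \<Longrightarrow> a z (x + y) = a z x + a z y"
    and "\<And>x z r. x \<in> S \<Longrightarrow> z \<in> S \<Longrightarrow> subspace S \<Longrightarrow> a z (r *\<^sub>R x) = r * a z x"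
proof -
  show sym: "\<And>x y. x \<in> S \<Longrightarrow> y \<in> S \<Longrightarrow> a x y = a y x"
    and "\<And>x. x \<in> S \<Longrightarrow> 0 \<le> a x x"
    and add: "\<And>x y z. x \<in> S \<Longrightarrow> y \<in> S \<Longrightarrow> z \<in> S \<Longrightarrow> a (x + y) z = a x z + a y z"
    and scale: "\<And>x z r. x \<in> S \<Longrightarrow> z \<in> S \<Longrightarrow> a (r *\<^sub>R x) z = r * a x z"
    using assms unfolding psd_form_on_def by blast+
  show "\<And>x y z. x \<in> S \<Longrightarrow> y \<in> S \<Longrightarrow> z \<in> S \<Longrightarrow> subspace S \<Longrightarrow> a z (x + y) = a z x + a z y"
    using sym add by (simp add: subspace_add)
  show "\<And>x z r. x \<in> S \<Longrightarrow> z \<in> S \<Longrightarrow> subspace S \<Longrightarrow> a z (r *\<^sub>R x) = r * a z x"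
    using sym scale by (simp add: subspace_scale)
qed

lemma quadratic_onI:
  assumes "psd_form_on S a" "linear_form_on S L" "\<And>x. x \<in> S \<Longrightarrow> J x = a x x - 2 * L x + C"
  shows "quadratic_on S a J"
  unfolding quadratic_on_def using assms by (intro conjI exI[of _ L] exI[of _ C]) auto

lemma quadratic_onE:
  assumes "quadratic_on S a J"
  obtains L C where "psd_form_on S a" "linear_form_on S L" "\<forall>x\<in>S. J x = a x x - 2 * L x + C"
  using assms that unfolding quadratic_on_def by blast

lemma quadratic_on_add:
  assumes "quadratic_on S a J" "quadratic_on S b K"
  shows "quadratic_on S (\<lambda>x y. a x y + b x y) (\<lambda>x. J x + K x)"
proof -
  obtain L C where L: "psd_form_on S a" "linear_form_on S L" "\<forall>x\<in>S. J x = a x x - 2 * L x + C"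
    using assms(1) by (rule quadratic_onE)
  obtain M E where M: "psd_form_on S b" "linear_form_on S M" "\<forall>x\<in>S. K x = b x x - 2 * M x + E"
    using assms(2) by (rule quadratic_onE)
  show ?thesis
  proof (rule quadratic_onI)
    show "linear_form_on S (\<lambda>x. L x + M x)"
      using L(2) M(2) by (simp add: linear_form_on_def distrib_left)
    show "J x + K x = (a x x + b x x) - 2 * (L x + M x) + (C + E)" if "x \<in> S" for x
      using L(3) M(3) that by simp
    show "psd_form_on S (\<lambda>x y. a x y + b x y)"
      using L(1) M(1) unfolding psd_form_on_def by (simp add: distrib_left)
  qed
qed

lemma quadratic_on_scale:
  assumes "quadratic_on S a J" "0 \<le> r"
  shows "quadratic_on S (\<lambda>x y. r * a x y) (\<lambda>x. r * J x)"
proof -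
  obtain L C where L: "psd_form_on S a" "linear_form_on S L" "\<forall>x\<in>S. J x = a x x - 2 * L x + C"
    using assms(1) by (rule quadratic_onE)
  show ?thesis
  proof (rule quadratic_onI)
    show "linear_form_on S (\<lambda>x. r * L x)"
      using L(2) by (simp add: linear_form_on_def distrib_left)
    show "r * J x = r * a x x - 2 * (r * L x) + r * C" if "x \<in> S" for x
      using L(3) that by (simp add: right_diff_distrib distrib_left)
    show "psd_form_on S (\<lambda>x y. r * a x y)"
      using L(1) assms(2) unfolding psd_form_on_def by (simp add: distrib_left)
  qed
qed

text \<open>A Gram-Schmidt step for each new vector: subtract from \<open>b\<close> its
  \<open>a\<close>-projection onto the old span, then correct the old representative along the
  orthogonal remainder \<open>w\<close>. \<open>B\<close> may be dependent, so \<open>w = 0\<close>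
  can occur; the correction is then zero.\<close>

lemma riesz_on_span:
  assumes S: "subspace S" and a: "psd_form_on S a"
    and definite: "\<And>x. x \<in> S \<Longrightarrow> a x x = 0 \<Longrightarrow> x = 0"
    and L: "linear_form_on S L" and B: "finite B" "B \<subseteq> S"
  shows "\<exists>x\<in>span B. \<forall>y\<in>span B. a x y = L y"
  using B L
proof (induction B arbitrary: L)
  case empty
  have "L 0 = 0" using empty(2) subspace_0[OF S] unfolding linear_form_on_def
    by (metis mult_zero_left scaleR_zero_left)
  moreover have "a 0 0 = 0" using psd_form_onD(4)[OF a, of 0 0 0] subspace_0[OF S] by simp
  ultimately show ?case by simp
next
  case (insert b B)
  note a' = psd_form_onD[OF a]
  have BS: "span B \<subseteq> S" and b: "b \<in> S"
    using insert.prems S span_minimal[of B S] by blast+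
  have "linear_form_on S (a b)"
    unfolding linear_form_on_def using b S a'(5,6) by simp
  \<comment> \<open>The projection of \<open>b\<close> is the representative of the functional
    \<open>a b\<close>. This second use of the induction hypothesis is why \<open>L\<close> is
    arbitrary in the induction.\<close>
  then obtain p where p: "p \<in> span B" "\<forall>y\<in>span B. a p y = a b y"
    using insert.IH[of "a b"] insert.prems by auto
  obtain u where u: "u \<in> span B" "\<forall>y\<in>span B. a u y = L y"
    using insert.IH[of L] insert.prems by auto
  define w where "w = b - p"
  have bw: "b = p + w" by (simp add: w_def)
  have wS: "w \<in> S" using b p(1) BS S by (auto simp: w_def intro: subspace_diff)
  have pS: "p \<in> S" and uS: "u \<in> S" using p u BS by auto
  have orth: "a w y = 0" if "y \<in> span B" for y
    using a'(3)[OF pS wS, of y] p(2) that BS unfolding bw by auto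
  \<comment> \<open>The multiple of \<open>w\<close> leaves the values on \<open>span B\<close>
    unchanged, and its coefficient solves \<open>a x w = L w\<close>.\<close>
  define x where "x = u + ((L w - a u w) / a w w) *\<^sub>R w"
  have "a x y = L y" if y: "y \<in> span (insert b B)" for y
  proof -
    obtain r where r: "y - r *\<^sub>R b \<in> span B" using y span_breakdown_eq by blast
    define z where "z = y - r *\<^sub>R w"
    have "z = (y - r *\<^sub>R b) + r *\<^sub>R p" by (simp add: z_def bw algebra_simps)
    then have z: "z \<in> span B" using r p(1) by (simp add: span_add span_scale)
    then have zS: "z \<in> S" using BS by auto
    have yz: "y = z + r *\<^sub>R w" by (simp add: z_def)
    have rwS: "\<And>r. r *\<^sub>R w \<in> S" using wS S by (simp add: subspace_scale)
    have xz: "a x z = L z"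
      unfolding x_def using a'(3)[OF uS rwS zS] a'(4)[OF wS zS] orth[OF z] u(2) z by simp
    have xw: "a x w = L w"
    proof (cases "w = 0")
      case True
      have "x \<in> S" unfolding x_def using uS rwS S by (simp add: subspace_add)
      then have "a x (0 *\<^sub>R w) = 0" using a'(6)[OF wS _ S, of x 0] by simp
      moreover have "L (0 *\<^sub>R w) = 0 * L w"
        using insert.prems(2) wS unfolding linear_form_on_def by blast
      ultimately show ?thesis using True by simp
    next
      case False
      then have "a w w \<noteq> 0" using definite wS by blast
      then show ?thesis unfolding x_def using a'(3)[OF uS rwS wS] a'(4)[OF wS wS] by simp
    qed
    have xS: "x \<in> S" unfolding x_def using uS rwS S by (simp add: subspace_add)
    have "a x y = a x z + r * a x w"
      unfolding yz using a'(5)[OF zS rwS xS S] a'(6)[OF wS xS S] by simp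
    also have "\<dots> = L y" unfolding yz xz xw
      using insert.prems(2) zS wS rwS unfolding linear_form_on_def by simp
    finally show ?thesis .
  qed
  moreover have "x \<in> span (insert b B)"
  proof -
    have "span B \<subseteq> span (insert b B)" by (rule span_mono) auto
    then have "u \<in> span (insert b B)" "p \<in> span (insert b B)" using u p by auto
    then show ?thesis unfolding x_def w_def
      by (intro span_add span_scale span_diff) (auto intro: span_base)
  qed
  ultimately show ?case by blast
qed

text \<open>Completing the square: once \<open>a x\<close> represents \<open>L\<close>, the excess
  \<open>J y - J x\<close> equals \<open>a (y - x) (y - x)\<close>, which yields minimality and
  uniqueness together. \<open>T\<close> may lie outside \<open>S\<close>, so monomial fields can
  serve although they need not be divergence-free.\<close>

lemma quadratic_on_ex1_minimizer:
  assumes S: "subspace S" and fin: "finite T" "S \<subseteq> span T" and J: "quadratic_on S a J"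
    and definite: "\<And>x. x \<in> S \<Longrightarrow> a x x = 0 \<Longrightarrow> x = 0"
  shows "\<exists>!x. x \<in> S \<and> (\<forall>y\<in>S. J x \<le> J y)"
proof -
  obtain L C where a: "psd_form_on S a" and L: "linear_form_on S L"
    and JL: "\<forall>x\<in>S. J x = a x x - 2 * L x + C"
    using J by (rule quadratic_onE)
  obtain B where B: "B \<subseteq> S" "independent B" "S \<subseteq> span B"
    using maximal_independent_subset[of S] by auto
  have "finite B" using independent_span_bound[OF fin(1) B(2)] B(1) fin(2) by auto
  from riesz_on_span[OF S a definite L this B(1)]
  obtain x where "x \<in> span B" "\<forall>y\<in>span B. a x y = L y" by blast
  moreover have "span B = S" using B(3) span_minimal[OF B(1) S] by (rule equalityI[rotated])
  ultimately have x: "x \<in> S" "\<And>y. y \<in> S \<Longrightarrow> a x y = L y" by simp_all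
  note a' = psd_form_onD[OF a]
  have key: "J y = J x + a (y - x) (y - x)" if y: "y \<in> S" for y
  proof -
    have d: "y - x \<in> S" using x y S by (simp add: subspace_diff)
    have "a y y = a (x + (y - x)) y" by simp
    also have "\<dots> = a x (x + (y - x)) + a (y - x) (x + (y - x))"
      using a'(3)[OF x(1) d y] by simp
    also have "\<dots> = a x x + 2 * a x (y - x) + a (y - x) (y - x)"
      unfolding a'(5)[OF x(1) d x(1) S] a'(5)[OF x(1) d d S] a'(1)[OF d x(1)] by simp
    finally have "a y y = a x x + 2 * L (y - x) + a (y - x) (y - x)" using x d by simp
    moreover have "L y = L x + L (y - x)"
    proof -
      have "L (x + (y - x)) = L x + L (y - x)"
        using L x(1) d unfolding linear_form_on_def by blast
      then show ?thesis by simp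
    qed
    ultimately show ?thesis using JL x(1) y by simp
  qed
  show ?thesis
  proof (rule ex1I[of _ x])
    show "x \<in> S \<and> (\<forall>y\<in>S. J x \<le> J y)"
    proof (intro conjI ballI)
      show "J x \<le> J y" if "y \<in> S" for y
        using key[OF that] a'(2)[of "y - x"] subspace_diff[OF S that x(1)] by linarith
    qed (fact x(1))
  next
    fix y assume "y \<in> S \<and> (\<forall>z\<in>S. J y \<le> J z)"
    then have y: "y \<in> S" "J y \<le> J x" using x by auto
    then have "a (y - x) (y - x) = 0"
      using key[OF y(1)] a'(2)[of "y - x"] subspace_diff[OF S y(1) x(1)] by linarith
    then show "y = x" using definite[OF subspace_diff[OF S y(1) x(1)]] by simp
  qed
qed

section \<open>Square-integrable residuals and least squares functionals\<close>

definition sq_integrable :: "'m measure \<Rightarrow> ('m \<Rightarrow> 'b::euclidean_space) \<Rightarrow> bool" where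
  "sq_integrable M f \<longleftrightarrow> f \<in> borel_measurable M \<and> integrable M (\<lambda>z. (norm (f z))\<^sup>2)"

lemma sq_integrable_inner:
  assumes "sq_integrable M f" "sq_integrable M g"
  shows "integrable M (\<lambda>z. f z \<bullet> g z)"
proof (rule Bochner_Integration.integrable_bound)
  show "integrable M (\<lambda>z. (norm (f z))\<^sup>2 + (norm (g z))\<^sup>2)"
    using assms by (simp add: sq_integrable_def)
  show "(\<lambda>z. f z \<bullet> g z) \<in> borel_measurable M"
    using assms by (auto simp: sq_integrable_def)
  have "\<bar>x \<bullet> y\<bar> \<le> (norm x)\<^sup>2 + (norm y)\<^sup>2" for x y :: 'b
  proof -
    have "2 * (norm x * norm y) \<le> (norm x)\<^sup>2 + (norm y)\<^sup>2"
      using sum_squares_bound[of "norm x" "norm y"] by (simp add: algebra_simps)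
    moreover have "0 \<le> norm x * norm y" by simp
    ultimately show ?thesis using Cauchy_Schwarz_ineq2[of x y] by linarith
  qed
  then show "AE z in M. norm (f z \<bullet> g z) \<le> norm ((norm (f z))\<^sup>2 + (norm (g z))\<^sup>2)"
    by simp
qed

lemma sq_integrable_diff:
  assumes "sq_integrable M f" "sq_integrable M g"
  shows "sq_integrable M (\<lambda>z. f z - g z)"
proof -
  have "(norm (f z - g z))\<^sup>2 = (norm (f z))\<^sup>2 - 2 * (f z \<bullet> g z) + (norm (g z))\<^sup>2" for z
    by (simp add: power2_norm_eq_inner inner_diff inner_commute)
  then show ?thesis using assms sq_integrable_inner[OF assms] by (auto simp: sq_integrable_def)
qed

lemma sq_integrable_scaleR: "sq_integrable M f \<Longrightarrow> sq_integrable M (\<lambda>z. r *\<^sub>R f z)"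
  by (auto simp: sq_integrable_def power_mult_distrib)

text \<open>Expanding the squared norm of \<open>A x - b\<close> produces the form, the linear part
  and the constant; the mixed integrals exist because both factors are square-integrable.\<close>

lemma quadratic_on_square_integral:
  fixes A :: "'a::real_vector \<Rightarrow> 'm \<Rightarrow> 'b::euclidean_space"
  assumes S: "subspace S" and A: "\<And>x. x \<in> S \<Longrightarrow> sq_integrable M (A x)" and b: "sq_integrable M b"
    and add: "\<And>x y z. x \<in> S \<Longrightarrow> y \<in> S \<Longrightarrow> A (x + y) z = A x z + A y z"
    and scale: "\<And>x r z. x \<in> S \<Longrightarrow> A (r *\<^sub>R x) z = r *\<^sub>R A x z"
  shows "quadratic_on S (\<lambda>x y. \<integral>z. A x z \<bullet> A y z \<partial>M)
           (\<lambda>x. \<integral>z. (A x z - b z) \<bullet> (A x z - b z) \<partial>M)"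
proof -
  have I: "integrable M (\<lambda>z. A x z \<bullet> A y z)" "integrable M (\<lambda>z. A x z \<bullet> b z)" "integrable M (\<lambda>z. b z \<bullet> b z)"
    if "x \<in> S" "y \<in> S" for x y
    using A b that by (auto intro: sq_integrable_inner)
  show ?thesis
  proof (rule quadratic_onI)
    show "(\<integral>z. (A x z - b z) \<bullet> (A x z - b z) \<partial>M) =
        (\<integral>z. A x z \<bullet> A x z \<partial>M) - 2 * (\<integral>z. A x z \<bullet> b z \<partial>M) + (\<integral>z. b z \<bullet> b z \<partial>M)"
      if "x \<in> S" for x
    proof -
      have "(A x z - b z) \<bullet> (A x z - b z) = A x z \<bullet> A x z - 2 * (A x z \<bullet> b z) + b z \<bullet> b z" for z
        by (simp add: inner_diff inner_commute)
      then show ?thesis using I that by simp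
    qed
    show "linear_form_on S (\<lambda>x. \<integral>z. A x z \<bullet> b z \<partial>M)"
      unfolding linear_form_on_def using I S by (simp add: add scale inner_add_left)
    show "psd_form_on S (\<lambda>x y. \<integral>z. A x z \<bullet> A y z \<partial>M)"
      unfolding psd_form_on_def
    proof (intro conjI ballI allI)
      show "(\<integral>z. A x z \<bullet> A y z \<partial>M) = (\<integral>z. A y z \<bullet> A x z \<partial>M)" for x y
        by (simp add: inner_commute)
    qed (use I in \<open>simp_all add: add scale inner_add_left\<close>)
  qed
qed

lemma square_integral_eq_0_AE:
  assumes "sq_integrable M f" "(\<integral>z. f z \<bullet> f z \<partial>M) = 0"
  shows "AE z in M. f z = 0"
  using assms sq_integrable_inner[OF assms(1) assms(1)]
  by (subst (asm) integral_nonneg_eq_0_iff_AE) auto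

section \<open>Polynomials in space and time\<close>

type_synonym exponents = "nat \<times> nat \<times> nat \<times> nat"

definition exponents_le :: "nat \<Rightarrow> exponents set" where
  "exponents_le k = {(i, j, l, m). i + j + l + m \<le> k}"

definition mon :: "exponents \<Rightarrow> scalar_field" where
  "mon = (\<lambda>(i, j, l, m) x t. (x $ 1) ^ i * (x $ 2) ^ j * (x $ 3) ^ l * t ^ m)"

text \<open>Encoding time as \<open>None\<close> and the space directions as \<open>Some i\<close>
  lets one induction step treat all four first derivatives alike.\<close>

definition pd :: "3 option \<Rightarrow> scalar_field \<Rightarrow> scalar_field" where
  "pd d p x t = (case d of None \<Rightarrow> deriv (\<lambda>s. p x s) t | Some i \<Rightarrow> partial_space i p x t)"

definition expo :: "3 option \<Rightarrow> exponents \<Rightarrow> nat" where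
  "expo d = (\<lambda>(i, j, l, m).
     case d of None \<Rightarrow> m | Some q \<Rightarrow> if q = 1 then i else if q = 2 then j else l)"

text \<open>Truncation in \<open>lower\<close> is harmless: \<open>lower d \<alpha>\<close> only occurs multiplied by \<open>expo d \<alpha>\<close>.\<close>

definition lower :: "3 option \<Rightarrow> exponents \<Rightarrow> exponents" where
  "lower d = (\<lambda>(i, j, l, m).
     case d of None \<Rightarrow> (i, j, l, m - 1)
     | Some q \<Rightarrow> if q = 1 then (i - 1, j, l, m) else if q = 2 then (i, j - 1, l, m) else (i, j, l - 1, m))"

lemma finite_exponents_le: "finite (exponents_le k)"
  unfolding exponents_le_def by (rule finite_exponents)

lemma poly_space_iff:
  "p \<in> poly_space k \<longleftrightarrow> (\<exists>a. p = (\<lambda>x t. \<Sum>\<alpha>\<in>exponents_le k. a \<alpha> * mon \<alpha> x t))"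
proof
  assume "p \<in> poly_space k"
  then obtain a where "\<And>x t. p x t = (\<Sum>(i, j, l, m) \<in> exponents_le k.
                   a i j l m * (x $ 1) ^ i * (x $ 2) ^ j * (x $ 3) ^ l * t ^ m)"
    unfolding poly_space_def exponents_le_def by auto
  then have "p = (\<lambda>x t. \<Sum>\<alpha>\<in>exponents_le k. (\<lambda>(i, j, l, m). a i j l m) \<alpha> * mon \<alpha> x t)"
    by (auto simp: mon_def fun_eq_iff split_def mult.assoc)
  then show "\<exists>a. p = (\<lambda>x t. \<Sum>\<alpha>\<in>exponents_le k. a \<alpha> * mon \<alpha> x t)" by blast
next
  assume "\<exists>a. p = (\<lambda>x t. \<Sum>\<alpha>\<in>exponents_le k. a \<alpha> * mon \<alpha> x t)"
  then obtain a where "p = (\<lambda>x t. \<Sum>\<alpha>\<in>exponents_le k. a \<alpha> * mon \<alpha> x t)" by blast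
  then have "\<forall>x t. p x t = (\<Sum>(i, j, l, m) \<in> exponents_le k.
       (\<lambda>i j l m. a (i, j, l, m)) i j l m * (x $ 1) ^ i * (x $ 2) ^ j * (x $ 3) ^ l * t ^ m)"
    by (auto simp: mon_def split_def mult.assoc)
  then show "p \<in> poly_space k" unfolding poly_space_def exponents_le_def
    by (intro CollectI exI[of _ "\<lambda>i j l m. a (i, j, l, m)"])
qed

text \<open>The full derivative is needed, not only the partial ones, because fields are later
  differentiated along arbitrary tangent directions of the surface.\<close>

lemma mon_has_derivative:
  "((\<lambda>x. mon \<alpha> x t) has_derivative
     (\<lambda>h. \<Sum>i\<in>UNIV. h $ i * (expo (Some i) \<alpha> * mon (lower (Some i) \<alpha>) x t))) (at x)"
proof -
  obtain i j l m where \<alpha>: "\<alpha> = (i, j, l, m)" by (cases \<alpha>)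
  have nth: "((\<lambda>x::real^3. x $ q) has_derivative (\<lambda>h. h $ q)) (at x)" for q x
    by (rule bounded_linear_imp_has_derivative) (rule bounded_linear_vec_nth)
  show ?thesis
    unfolding \<alpha> mon_def lower_def expo_def split_conv option.case
    by (rule derivative_eq_intros nth refl)+ (auto simp: sum_3 fun_eq_iff algebra_simps)
qed

lemma mon_has_time_derivative:
  "((\<lambda>s. mon \<alpha> x s) has_field_derivative (expo None \<alpha> * mon (lower None \<alpha>) x t)) (at t)"
proof -
  obtain i j l m where \<alpha>: "\<alpha> = (i, j, l, m)" by (cases \<alpha>)
  show ?thesis
    unfolding \<alpha> mon_def lower_def expo_def split_conv option.case
    by (rule derivative_eq_intros refl)+ (auto simp: algebra_simps)
qed

lemma partial_space_eqI:
  assumes "((\<lambda>x. p x t) has_derivative (\<lambda>h. \<Sum>i\<in>UNIV. h $ i * q i)) (at x)"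
  shows "partial_space i p x t = q i"
proof -
  have "((\<lambda>s::real. x + s *\<^sub>R axis i 1) has_derivative (\<lambda>s. s *\<^sub>R axis i 1)) (at 0)"
    by (auto intro!: derivative_eq_intros)
  moreover have "((\<lambda>x. p x t) has_derivative (\<lambda>h. \<Sum>i\<in>UNIV. h $ i * q i)) (at (x + 0 *\<^sub>R axis i 1))"
    using assms by simp
  ultimately have "((\<lambda>s. p (x + s *\<^sub>R axis i 1) t) has_derivative
      (\<lambda>s. \<Sum>j\<in>UNIV. (s *\<^sub>R axis i 1) $ j * q j)) (at 0)"
    by (rule has_derivative_compose)
  moreover have "(\<Sum>j\<in>UNIV. (s *\<^sub>R axis i 1) $ j * q j) = q i * s" for s
  proof -
    have "(s *\<^sub>R axis i 1) $ j * q j = (if j = i then s * q j else 0)" for j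
      by (simp add: axis_def)
    then show ?thesis by simp
  qed
  ultimately show ?thesis
    unfolding partial_space_def by (intro DERIV_imp_deriv) (simp add: has_field_derivative_def)
qed

text \<open>The reindexing \<open>h\<close> makes the formula iterable: after one derivative the sum
  runs over \<open>mon (lower e \<alpha>)\<close> and is no longer indexed by its own exponents. The
  second derivatives in \<open>pd_commute\<close> are taken in this form.\<close>

lemma pd_sum_mon:
  assumes "finite A"
  shows "pd d (\<lambda>x t. \<Sum>\<alpha>\<in>A. b \<alpha> * mon (h \<alpha>) x t) =
           (\<lambda>x t. \<Sum>\<alpha>\<in>A. b \<alpha> * expo d (h \<alpha>) * mon (lower d (h \<alpha>)) x t)"
    and "((\<lambda>x. \<Sum>\<alpha>\<in>A. b \<alpha> * mon (h \<alpha>) x t) has_derivative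
           (\<lambda>v. \<Sum>i\<in>UNIV. v $ i * (\<Sum>\<alpha>\<in>A. b \<alpha> * expo (Some i) (h \<alpha>) * mon (lower (Some i) (h \<alpha>)) x t))) (at x)"
    and "((\<lambda>s. \<Sum>\<alpha>\<in>A. b \<alpha> * mon (h \<alpha>) x s) has_field_derivative
           (\<Sum>\<alpha>\<in>A. b \<alpha> * expo None (h \<alpha>) * mon (lower None (h \<alpha>)) x t)) (at t)"
proof -
  have 1: "((\<lambda>x. \<Sum>\<alpha>\<in>A. b \<alpha> * mon (h \<alpha>) x t) has_derivative
           (\<lambda>v. \<Sum>i\<in>UNIV. v $ i * (\<Sum>\<alpha>\<in>A. b \<alpha> * expo (Some i) (h \<alpha>) * mon (lower (Some i) (h \<alpha>)) x t))) (at x)"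
    for x t
    by (rule has_derivative_eq_rhs, (rule has_derivative_sum has_derivative_mult_right mon_has_derivative)+)
      (simp add: fun_eq_iff sum_distrib_left sum.swap[of _ A] mult_ac)
  have 2: "((\<lambda>s. \<Sum>\<alpha>\<in>A. b \<alpha> * mon (h \<alpha>) x s) has_field_derivative
           (\<Sum>\<alpha>\<in>A. b \<alpha> * expo None (h \<alpha>) * mon (lower None (h \<alpha>)) x t)) (at t)" for x t
    unfolding mult.assoc by (intro DERIV_sum DERIV_cmult mon_has_time_derivative)
  show "((\<lambda>x. \<Sum>\<alpha>\<in>A. b \<alpha> * mon (h \<alpha>) x t) has_derivative
           (\<lambda>v. \<Sum>i\<in>UNIV. v $ i * (\<Sum>\<alpha>\<in>A. b \<alpha> * expo (Some i) (h \<alpha>) * mon (lower (Some i) (h \<alpha>)) x t))) (at x)"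
    by (fact 1)
  show "((\<lambda>s. \<Sum>\<alpha>\<in>A. b \<alpha> * mon (h \<alpha>) x s) has_field_derivative
           (\<Sum>\<alpha>\<in>A. b \<alpha> * expo None (h \<alpha>) * mon (lower None (h \<alpha>)) x t)) (at t)"
    by (fact 2)
  show "pd d (\<lambda>x t. \<Sum>\<alpha>\<in>A. b \<alpha> * mon (h \<alpha>) x t) =
           (\<lambda>x t. \<Sum>\<alpha>\<in>A. b \<alpha> * expo d (h \<alpha>) * mon (lower d (h \<alpha>)) x t)"
  proof (intro ext)
    fix x t
    show "pd d (\<lambda>x t. \<Sum>\<alpha>\<in>A. b \<alpha> * mon (h \<alpha>) x t) x t =
           (\<Sum>\<alpha>\<in>A. b \<alpha> * expo d (h \<alpha>) * mon (lower d (h \<alpha>)) x t)"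
      using partial_space_eqI[OF 1] DERIV_imp_deriv[OF 2]
      by (cases d) (simp_all add: pd_def)
  qed
qed

lemma poly_has_derivative:
  assumes "p \<in> poly_space k"
  shows "((\<lambda>x. p x t) has_derivative (\<lambda>h. \<Sum>i\<in>UNIV. h $ i * pd (Some i) p x t)) (at x)"
  using assms unfolding poly_space_iff
  by (auto simp: pd_sum_mon(1)[where h = "\<lambda>\<alpha>. \<alpha>", OF finite_exponents_le]
      intro!: pd_sum_mon(2)[where h = "\<lambda>\<alpha>. \<alpha>", OF finite_exponents_le])

lemma poly_has_time_derivative:
  assumes "p \<in> poly_space k"
  shows "((\<lambda>s. p x s) has_field_derivative pd None p x t) (at t)"
  using assms unfolding poly_space_iff
  by (auto simp: pd_sum_mon(1)[where h = "\<lambda>\<alpha>. \<alpha>", OF finite_exponents_le]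
      intro!: pd_sum_mon(3)[where h = "\<lambda>\<alpha>. \<alpha>", OF finite_exponents_le])

text \<open>On monomials the symmetry is a statement about exponents: lowering in two directions
  commutes, and so do the factors it produces.\<close>

lemma pd_commute:
  assumes "p \<in> poly_space k"
  shows "pd d (pd e p) = pd e (pd d p)"
proof -
  have ex: "expo e \<alpha> * expo d (lower e \<alpha>) = expo d \<alpha> * expo e (lower d \<alpha>)"
    and lo: "lower d (lower e \<alpha>) = lower e (lower d \<alpha>)" for \<alpha>
    by (cases \<alpha>; cases d; cases e; simp add: expo_def lower_def)+
  obtain a where p: "p = (\<lambda>x t. \<Sum>\<alpha>\<in>exponents_le k. a \<alpha> * mon \<alpha> x t)"
    using assms unfolding poly_space_iff by blast
  show ?thesis
    unfolding p pd_sum_mon(1)[where h = "\<lambda>\<alpha>. \<alpha>", OF finite_exponents_le]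
      pd_sum_mon(1)[where h = "lower e", OF finite_exponents_le]
      pd_sum_mon(1)[where h = "lower d", OF finite_exponents_le]
    using ex by (simp add: lo mult.assoc flip: of_nat_mult)
qed

lemma subspace_poly_space: "subspace (poly_space k)"
proof (rule subspaceI)
  show "0 \<in> poly_space k"
    unfolding poly_space_iff by (intro exI[of _ "\<lambda>_. 0"]) (simp add: fun_eq_iff)
  show "p + q \<in> poly_space k" if "p \<in> poly_space k" "q \<in> poly_space k" for p q
  proof -
    obtain a b where "p = (\<lambda>x t. \<Sum>\<alpha>\<in>exponents_le k. a \<alpha> * mon \<alpha> x t)"
      "q = (\<lambda>x t. \<Sum>\<alpha>\<in>exponents_le k. b \<alpha> * mon \<alpha> x t)"
      using \<open>p \<in> _\<close> \<open>q \<in> _\<close> unfolding poly_space_iff by blast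
    then show ?thesis unfolding poly_space_iff
      by (intro exI[of _ "\<lambda>\<alpha>. a \<alpha> + b \<alpha>"]) (simp add: fun_eq_iff sum.distrib distrib_right)
  qed
  show "r *\<^sub>R p \<in> poly_space k" if "p \<in> poly_space k" for r p
  proof -
    obtain a where "p = (\<lambda>x t. \<Sum>\<alpha>\<in>exponents_le k. a \<alpha> * mon \<alpha> x t)"
      using \<open>p \<in> _\<close> unfolding poly_space_iff by blast
    then show ?thesis unfolding poly_space_iff
      by (intro exI[of _ "\<lambda>\<alpha>. r * a \<alpha>"]) (simp add: fun_eq_iff sum_distrib_left mult.assoc)
  qed
qed

lemma mon_in_poly_space: "\<alpha> \<in> exponents_le k \<Longrightarrow> mon \<alpha> \<in> poly_space k"
  unfolding poly_space_iff
  by (intro exI[of _ "\<lambda>\<beta>. if \<beta> = \<alpha> then 1 else 0"])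
    (simp add: fun_eq_iff finite_exponents_le if_distrib[of "\<lambda>c. c * _"] cong: if_cong)

lemma pd_in_poly_space:
  assumes "p \<in> poly_space k"
  shows "pd d p \<in> poly_space (k - 1)"
proof -
  obtain a where p: "p = (\<lambda>x t. \<Sum>\<alpha>\<in>exponents_le k. a \<alpha> * mon \<alpha> x t)"
    using assms unfolding poly_space_iff by blast
  have "pd d p = (\<Sum>\<alpha>\<in>exponents_le k. (a \<alpha> * expo d \<alpha>) *\<^sub>R mon (lower d \<alpha>))"
    unfolding p pd_sum_mon(1)[where h = "\<lambda>\<alpha>. \<alpha>", OF finite_exponents_le]
    by (simp add: fun_eq_iff sum_fun_apply)
  also have "\<dots> \<in> poly_space (k - 1)"
  proof (rule subspace_sum[OF subspace_poly_space])
    fix \<alpha> assume "\<alpha> \<in> exponents_le k"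
    \<comment> \<open>If the exponent is 0, truncated subtraction does not lower the degree, but the
      coefficient removes the term. For \<open>k = 0\<close> every exponent is 0, so the truncated
      \<open>k - 1\<close> is harmless.\<close>
    then have "expo d \<alpha> = 0 \<or> lower d \<alpha> \<in> exponents_le (k - 1)"
      by (cases d) (auto simp: exponents_le_def expo_def lower_def split: if_splits)
    then show "(a \<alpha> * expo d \<alpha>) *\<^sub>R mon (lower d \<alpha>) \<in> poly_space (k - 1)"
      using subspace_0[OF subspace_poly_space] subspace_scale[OF subspace_poly_space] mon_in_poly_space
      by (metis mult_zero_right of_nat_0 scaleR_zero_left)
  qed
  finally show ?thesis .
qed

text \<open>\<open>deriv\<close> is additive only where derivatives exist, hence the restriction to
  polynomials.\<close>

lemma pd_add:
  assumes "p \<in> poly_space k" "q \<in> poly_space k"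
  shows "pd d (p + q) x t = pd d p x t + pd d q x t"
proof (cases d)
  case None
  have "((p + q) x has_field_derivative pd None p x t + pd None q x t) (at t)"
    using DERIV_add[OF poly_has_time_derivative[OF assms(1)] poly_has_time_derivative[OF assms(2)]]
    by (simp add: plus_fun_def)
  from DERIV_imp_deriv[OF this] show ?thesis using None by (simp add: pd_def)
next
  case (Some i)
  have "((\<lambda>x. (p + q) x t) has_derivative
      (\<lambda>h. \<Sum>i\<in>UNIV. h $ i * (pd (Some i) p x t + pd (Some i) q x t))) (at x)"
    using has_derivative_add[OF poly_has_derivative[OF assms(1)] poly_has_derivative[OF assms(2)]]
    by (simp add: distrib_left sum.distrib)
  from partial_space_eqI[of "p + q", OF this] show ?thesis using Some by (simp add: pd_def)
qed

lemma pd_scaleR: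
  assumes "p \<in> poly_space k"
  shows "pd d (r *\<^sub>R p) x t = r * pd d p x t"
proof (cases d)
  case None
  have "((r *\<^sub>R p) x has_field_derivative r * pd None p x t) (at t)"
    using DERIV_cmult[OF poly_has_time_derivative[OF assms(1)]] by (simp add: scaleR_fun_def)
  from DERIV_imp_deriv[OF this] show ?thesis using None by (simp add: pd_def)
next
  case (Some i)
  have "((\<lambda>x. (r *\<^sub>R p) x t) has_derivative (\<lambda>h. \<Sum>i\<in>UNIV. h $ i * (r * pd (Some i) p x t))) (at x)"
    using has_derivative_mult_right[OF poly_has_derivative[OF assms(1)]]
    by (simp add: sum_distrib_left mult_ac)
  from partial_space_eqI[of "r *\<^sub>R p", OF this] show ?thesis using Some by (simp add: pd_def)
qed

lemma poly_continuous:
  assumes "p \<in> poly_space k"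
  shows "continuous_on UNIV (\<lambda>z. p (fst z) (snd z))"
proof -
  have "continuous_on UNIV (\<lambda>z. mon \<alpha> (fst z) (snd z))" for \<alpha>
    by (cases \<alpha>) (auto simp: mon_def intro!: continuous_intros)
  then show ?thesis
    using assms unfolding poly_space_iff by (auto intro!: continuous_intros)
qed

lemma poly_constant:
  assumes p: "p \<in> poly_space k" and zero: "\<And>d x t. pd d p x t = 0"
  shows "p x t = p y s"
proof -
  have "p x t = p y t"
  proof (rule has_derivative_zero_unique[of UNIV "\<lambda>x. p x t"])
    show "((\<lambda>x. p x t) has_derivative (\<lambda>h. 0)) (at z within UNIV)" for z
      using poly_has_derivative[OF p, of t z] by (simp add: zero)
  qed auto
  also have "p y t = p y s"
    using poly_has_time_derivative[OF p] zero by (intro DERIV_isconst_all allI) metis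
  finally show ?thesis .
qed

lemma poly_space_0_constant: "p \<in> poly_space 0 \<Longrightarrow> p x t = p y s"
  by (auto simp: poly_space_iff exponents_le_def mon_def)

section \<open>Zero sets and area of surfaces\<close>

lemma positive_along_direction:
  fixes \<phi> :: "'a::real_inner \<Rightarrow> real"
  assumes "(\<phi> has_derivative (\<lambda>h. G \<bullet> h)) (at p)" "\<phi> p = 0" "0 < G \<bullet> w"
  shows "\<exists>d>0. \<forall>s>0. s < d \<longrightarrow> 0 < \<phi> (p + s *\<^sub>R w)"
proof -
  have "((\<lambda>s::real. p + s *\<^sub>R w) has_derivative (\<lambda>s. s *\<^sub>R w)) (at 0)"
    by (auto intro!: derivative_eq_intros)
  moreover have "(\<phi> has_derivative (\<lambda>h. G \<bullet> h)) (at (p + 0 *\<^sub>R w))"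
    using assms by simp
  ultimately have "((\<lambda>s. \<phi> (p + s *\<^sub>R w)) has_derivative (\<lambda>s. G \<bullet> (s *\<^sub>R w))) (at 0)"
    by (rule has_derivative_compose)
  then have "((\<lambda>s. \<phi> (p + s *\<^sub>R w)) has_real_derivative G \<bullet> w) (at 0)"
    by (simp add: has_field_derivative_def mult_commute_abs)
  from DERIV_pos_inc_right[OF this assms(3)] show ?thesis
    using assms(2) by auto
qed

lemma negative_along_direction:
  fixes \<phi> :: "'a::real_inner \<Rightarrow> real"
  assumes "(\<phi> has_derivative (\<lambda>h. G \<bullet> h)) (at p)" "\<phi> p = 0" "G \<bullet> w < 0"
  shows "\<exists>d>0. \<forall>s>0. s < d \<longrightarrow> \<phi> (p + s *\<^sub>R w) < 0"
proof -
  have "((\<lambda>x. - \<phi> x) has_derivative (\<lambda>h. (- G) \<bullet> h)) (at p)"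
    using has_derivative_minus[OF assms(1)] by simp
  from positive_along_direction[OF this, of w] assms(2,3) show ?thesis by simp
qed

text \<open>
  No implicit function theorem is needed: for \<open>v\<close> orthogonal to the gradient \<open>G\<close>, the function \<open>\<phi>\<close> changes
  sign between \<open>p + s (v - \<delta> G)\<close> and \<open>p + s (v + \<delta> G)\<close>, so the level set has a point in between.
\<close>

lemma tangential_derivative_eq_0:
  fixes \<phi> :: "'a::real_inner \<Rightarrow> real" and f :: "'a \<Rightarrow> real"
  assumes U: "open U" "p \<in> U" and cont: "continuous_on U \<phi>"
    and \<phi>: "(\<phi> has_derivative (\<lambda>h. G \<bullet> h)) (at p)" "\<phi> p = 0" and G: "G \<noteq> 0"
    and f: "(f has_derivative f') (at p)" and zero: "\<And>x. x \<in> U \<Longrightarrow> \<phi> x = 0 \<Longrightarrow> f x = 0"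
    and v: "G \<bullet> v = 0"
  shows "f' v = 0"
proof -
  have lin: "linear f'" using f has_derivative_linear by blast
  \<comment> \<open>\<open>K\<close> collects the errors of order \<open>\<delta>\<close>: tilting
    the direction \<open>v\<close> by at most \<open>\<delta>\<close> along \<open>G\<close>, and
    linearizing \<open>f\<close> with relative accuracy \<open>\<delta>\<close>. As \<open>K\<close>
    does not depend on \<open>\<delta>\<close>, the bound forces \<open>f' v = 0\<close>.\<close>
  define K where "K = \<bar>f' G\<bar> + norm v + norm G"
  have bound: "\<bar>f' v\<bar> \<le> \<delta> * K" if \<delta>: "0 < \<delta>" "\<delta> \<le> 1" for \<delta>
  proof -
    have GG: "0 < G \<bullet> G" using G by simp
    obtain d1 where d1: "d1 > 0" "\<And>s. s > 0 \<Longrightarrow> s < d1 \<Longrightarrow> 0 < \<phi> (p + s *\<^sub>R (v + \<delta> *\<^sub>R G))"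
      using positive_along_direction[OF \<phi>, of "v + \<delta> *\<^sub>R G"] v GG \<delta> by (auto simp: inner_add_right)
    obtain d2 where d2: "d2 > 0" "\<And>s. s > 0 \<Longrightarrow> s < d2 \<Longrightarrow> \<phi> (p + s *\<^sub>R (v + (- \<delta>) *\<^sub>R G)) < 0"
      using negative_along_direction[OF \<phi>, of "v + (- \<delta>) *\<^sub>R G"] v GG \<delta> by (auto simp: inner_diff_right)
    obtain d3 where d3: "d3 > 0" "ball p d3 \<subseteq> U" using U open_contains_ball by blast
    obtain d4 where d4: "d4 > 0"
      "\<And>y. norm (y - p) < d4 \<Longrightarrow> norm (f y - f p - f' (y - p)) \<le> \<delta> * norm (y - p)"
      using f \<delta> unfolding has_derivative_at_alt by blast
    define N where "N = norm v + norm G + 1"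
    have N: "0 < N" unfolding N_def by (smt (verit) norm_ge_zero)
    \<comment> \<open>The step has to keep the signs of \<open>\<phi>\<close> at both tilted
      endpoints (\<open>d1\<close>, \<open>d2\<close>), stay in \<open>U\<close> (\<open>d3\<close>)
      and stay where \<open>f\<close> is linearized accurately (\<open>d4\<close>). The denominator
      makes both \<open>s\<close> and \<open>s * N\<close> smaller than the minimum.\<close>
    define s where "s = min (min d1 d2) (min d3 d4) / (2 * N + 2)"
    have m: "0 < min (min d1 d2) (min d3 d4)" using d1 d2 d3 d4 by simp
    have s: "0 < s" unfolding s_def using m N by (intro divide_pos_pos) auto
    have "s * (2 * N + 2) = min (min d1 d2) (min d3 d4)" unfolding s_def using N by simp
    then have "s * N + s * N + s + s = min (min d1 d2) (min d3 d4)" by (simp add: algebra_simps)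
    moreover have "0 < s * N" using s N by simp
    ultimately have s': "s < d1" "s < d2" "s * N < d3" "s * N < d4" using s by linarith+
    have near: "norm (s *\<^sub>R (v + \<eta> *\<^sub>R G)) \<le> s * (norm v + norm G)" if "\<bar>\<eta>\<bar> \<le> 1" for \<eta>
    proof -
      have "norm (v + \<eta> *\<^sub>R G) \<le> norm v + \<bar>\<eta>\<bar> * norm G"
        using norm_triangle_ineq[of v "\<eta> *\<^sub>R G"] by simp
      also have "\<dots> \<le> norm v + norm G" using that mult_right_mono[of "\<bar>\<eta>\<bar>" 1 "norm G"] by simp
      finally show ?thesis using s by simp
    qed
    have near': "norm (s *\<^sub>R (v + \<eta> *\<^sub>R G)) < s * N" if "\<bar>\<eta>\<bar> \<le> 1" for \<eta>
      using near[OF that] s unfolding N_def by (smt (verit) distrib_left mult_cancel_left1)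
    have "\<exists>\<eta>. - \<delta> \<le> \<eta> \<and> \<eta> \<le> \<delta> \<and> \<phi> (p + s *\<^sub>R (v + \<eta> *\<^sub>R G)) = 0"
    proof (rule IVT')
      have "p + s *\<^sub>R (v + \<eta> *\<^sub>R G) \<in> U" if "\<eta> \<in> {- \<delta>..\<delta>}" for \<eta>
      proof -
        have "\<bar>\<eta>\<bar> \<le> 1" using that \<delta> by auto
        from near'[OF this] s'(3) have "norm (s *\<^sub>R (v + \<eta> *\<^sub>R G)) < d3" by linarith
        then show ?thesis using d3(2) by (auto simp: dist_norm subset_eq)
      qed
      then show "continuous_on {- \<delta>..\<delta>} (\<lambda>\<eta>. \<phi> (p + s *\<^sub>R (v + \<eta> *\<^sub>R G)))"
        by (intro continuous_on_compose2[OF cont] continuous_intros) auto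
    qed (use d1(2)[of s] d2(2)[of s] s s' \<delta> in auto)
    then obtain \<eta> where \<eta>: "- \<delta> \<le> \<eta>" "\<eta> \<le> \<delta>" "\<phi> (p + s *\<^sub>R (v + \<eta> *\<^sub>R G)) = 0" by blast
    then have \<eta>1: "\<bar>\<eta>\<bar> \<le> 1" "\<bar>\<eta>\<bar> \<le> \<delta>" using \<delta> by auto
    define h where "h = s *\<^sub>R (v + \<eta> *\<^sub>R G)"
    have h: "norm h < d3" "norm h < d4" "norm h \<le> s * (norm v + norm G)"
      using near'[OF \<eta>1(1)] near[OF \<eta>1(1)] s' unfolding h_def by linarith+
    have "p + h \<in> U" using h(1) d3(2) by (auto simp: dist_norm subset_eq)
    then have "f (p + h) = 0" using zero \<eta>(3) by (simp add: h_def)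
    moreover have "f p = 0" using zero U \<phi> by simp
    ultimately have "\<bar>f' h\<bar> \<le> \<delta> * norm h" using d4(2)[of "p + h"] h(2) by simp
    also have "\<dots> \<le> \<delta> * (s * (norm v + norm G))" using h(3) \<delta> by (intro mult_left_mono) auto
    also have "f' h = s * (f' v + \<eta> * f' G)"
      unfolding h_def using lin by (simp add: linear_add linear_scale)
    finally have "s * \<bar>f' v + \<eta> * f' G\<bar> \<le> s * (\<delta> * (norm v + norm G))"
      using s by (simp add: abs_mult mult_ac)
    then have "\<bar>f' v + \<eta> * f' G\<bar> \<le> \<delta> * (norm v + norm G)" using s by simp
    moreover have "\<bar>\<eta> * f' G\<bar> \<le> \<delta> * \<bar>f' G\<bar>"
      using \<eta>1(2) by (simp add: abs_mult mult_right_mono)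
    ultimately show ?thesis unfolding K_def by (simp add: distrib_left)
  qed
  show ?thesis
  proof (rule ccontr)
    assume "f' v \<noteq> 0"
    then have pos: "0 < \<bar>f' v\<bar>" by simp
    have K: "0 \<le> K" unfolding K_def by simp
    \<comment> \<open>Chosen so that \<open>\<delta> * K\<close> is at most half of
      \<open>\<bar>f' v\<bar>\<close>.\<close>
    define \<delta> where "\<delta> = min 1 (\<bar>f' v\<bar> / (2 * (K + 1)))"
    have "0 < \<delta>" "\<delta> \<le> 1" unfolding \<delta>_def using pos K by auto
    then have "\<bar>f' v\<bar> \<le> \<delta> * K" by (rule bound)
    also have "\<dots> \<le> (\<bar>f' v\<bar> / (2 * (K + 1))) * (K + 1)"
      using K \<delta>_def \<open>0 < \<delta>\<close> by (intro mult_mono) auto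
    also have "\<dots> = \<bar>f' v\<bar> / 2" using K by (simp add: field_simps)
    finally show False using pos by simp
  qed
qed

section \<open>Measurability and local positivity of area for C1 surfaces\<close>

lemma C1_surface_borel:
  assumes "C1_surface \<Gamma>"
  shows "\<Gamma> \<in> sets borel"
proof -
  define \<U> where "\<U> = {U. open U \<and> open (U - \<Gamma>)}"
  have "\<exists>U\<in>\<U>. p \<in> U" if "p \<in> \<Gamma>" for p
  proof -
    from that assms obtain U \<phi> g where U: "open U" "p \<in> U"
      and \<phi>: "\<forall>x\<in>U. (\<phi> has_derivative (\<lambda>h. g x \<bullet> h)) (at x)" and \<Gamma>: "\<Gamma> \<inter> U = {x \<in> U. \<phi> x = (0::real)}"
      unfolding C1_surface_def by meson
    have "continuous_on U \<phi>"
      using \<phi> by (meson continuous_at_imp_continuous_on has_derivative_continuous)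
    then have "open (U \<inter> \<phi> -` (- {0}))"
      using U by (intro continuous_open_preimage) auto
    moreover have "U - \<Gamma> = U \<inter> \<phi> -` (- {0})" using \<Gamma> by auto
    ultimately show ?thesis using U by (auto simp: \<U>_def)
  qed
  \<comment> \<open>The surface need not be closed, but it is relatively closed in a union of open
    sets, hence a difference of two open sets. Taking all suitable open sets at once makes a
    countable atlas unnecessary.\<close>
  then have eq: "\<Gamma> = \<Union>\<U> - (\<Union>U\<in>\<U>. U - \<Gamma>)" by blast
  have "open (\<Union>\<U>)" "open (\<Union>U\<in>\<U>. U - \<Gamma>)"
    by (rule open_Union open_UN, simp add: \<U>_def)+
  then show ?thesis by (subst eq) (intro sets.Diff borel_open)
qed

text \<open>Such a box contains everything swept out by a set of diameter \<open>d\<close> around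
  \<open>x\<close> when it moves by at most \<open>a\<close> along the \<open>j\<close>-th axis. Its
  volume is of order \<open>d\<^sup>2\<close> for bounded \<open>d\<close>, the same order as the
  Hausdorff gauge.\<close>

lemma emeasure_thickened_box:
  fixes x :: "real^3"
  assumes "0 \<le> d" "0 \<le> a"
  shows "emeasure lborel (cbox (x - (\<chi> i. d + (if i = j then a else 0))) (x + (\<chi> i. d + (if i = j then a else 0))))
           = ennreal ((2 * d)\<^sup>2 * (2 * d + 2 * a))"
proof -
  let ?r = "\<chi> i. d + (if i = j then a else 0)"
  have "x \<in> cbox (x - ?r) (x + ?r)" using assms by (simp add: mem_box_cart)
  then have "measure lborel (cbox (x - ?r) (x + ?r)) = (\<Prod>i\<in>UNIV. 2 * d + (if i = j then 2 * a else 0))"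
    by (subst content_cbox_cart) (auto intro!: prod.cong)
  also have "\<dots> = (2 * d + 2 * a) * (\<Prod>i\<in>UNIV - {j}. 2 * d + (if i = j then 2 * a else 0))"
    by (subst prod.remove[of _ j]) auto
  also have "(\<Prod>i\<in>UNIV - {j}. 2 * d + (if i = j then 2 * a else 0)) = (\<Prod>i\<in>UNIV - {j}. 2 * d)"
    by (intro prod.cong) auto
  also have "\<dots> = (2 * d)\<^sup>2"
    by (simp add: card_Diff_singleton)
  finally show ?thesis
    by (simp only: emeasure_eq_ennreal_measure[OF emeasure_lborel_cbox_finite[THEN less_imp_neq, unfolded infinity_ennreal_def]] mult.commute)
qed

text \<open>
  If \<open>A\<close> had area zero, then the segments of length \<open>2 a\<close> through its points in a coordinate direction would
  sweep out a null set.
\<close>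

lemma hausdorff2_outer_pos:
  fixes A :: "(real^3) set"
  assumes "0 < \<rho>" "0 \<le> a"
    and sweep: "\<And>y. y \<in> ball p \<rho> \<Longrightarrow> \<exists>s. \<bar>s\<bar> \<le> a \<and> y + s *\<^sub>R axis j 1 \<in> A"
  shows "0 < hausdorff2_outer A"
proof (rule ccontr)
  assume "\<not> 0 < hausdorff2_outer A"
  then have "hausdorff2_outer A = 0" by simp
  moreover have "hausdorff2_pre 1 A \<le> hausdorff2_outer A"
    unfolding hausdorff2_outer_def by (rule SUP_upper) simp
  ultimately have pre: "hausdorff2_pre 1 A = 0" by simp
  let ?b = "emeasure lborel (ball p \<rho>)"
  \<comment> \<open>For \<open>d \<le> 1\<close> the box volume is at most
    \<open>4 * d\<^sup>2 * (2 + 2 * a)\<close>, which is \<open>K\<close> times the gauge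
    \<open>pi / 4 * d\<^sup>2\<close>. This is why coverings at scale 1 suffice.\<close>
  define K where "K = 16 * (2 + 2 * a) / pi"
  have K: "0 < K" unfolding K_def using assms by simp
  have "?b \<le> ennreal (K * e)" if "0 < e" for e
  proof -
    have "hausdorff2_pre 1 A < ennreal e" using pre that by simp
    then obtain C :: "nat \<Rightarrow> (real^3) set" where C: "A \<subseteq> (\<Union>i. C i)" "\<And>i. bounded (C i)" "\<And>i. diameter (C i) \<le> 1"
      and sum: "(\<Sum>i. ennreal (pi / 4 * (diameter (C i))\<^sup>2)) < ennreal e"
      unfolding hausdorff2_pre_def INF_less_iff by auto
    \<comment> \<open>For an empty \<open>C i\<close> the centre is arbitrary; only the volume of
      its box enters the estimate, and no point is assigned to it.\<close>
    define z where "z i = (SOME z. z \<in> C i)" for i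
    define r where "r i = (\<chi> q. diameter (C i) + (if q = j then a else 0))" for i
    have d0: "0 \<le> diameter (C i)" for i using C(2) by (rule diameter_ge_0)
    have "ball p \<rho> \<subseteq> (\<Union>i. cbox (z i - r i) (z i + r i))"
    proof
      fix y assume "y \<in> ball p \<rho>"
      then obtain s where s: "\<bar>s\<bar> \<le> a" "y + s *\<^sub>R axis j 1 \<in> A" using sweep by blast
      then obtain i where i: "y + s *\<^sub>R axis j 1 \<in> C i" using C by blast
      then have "z i \<in> C i" unfolding z_def by (rule someI)
      then have "norm (y + s *\<^sub>R axis j 1 - z i) \<le> diameter (C i)"
        using diameter_bounded_bound[OF C(2) i] by (simp add: dist_norm)
      then have "\<bar>(y + s *\<^sub>R axis j 1 - z i) $ q\<bar> \<le> diameter (C i)" for q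
        using component_le_norm_cart order_trans by blast
      then have comp: "\<bar>y $ q + (if q = j then s else 0) - z i $ q\<bar> \<le> diameter (C i)" for q
        by (simp add: axis_def if_distrib cong: if_cong)
      have "z i $ q - r i $ q \<le> y $ q \<and> y $ q \<le> z i $ q + r i $ q" for q
        using comp[of q] s(1) by (cases "q = j") (auto simp: r_def abs_le_iff)
      then have "y \<in> cbox (z i - r i) (z i + r i)"
        by (simp add: mem_box_cart)
      then show "y \<in> (\<Union>i. cbox (z i - r i) (z i + r i))" by blast
    qed
    then have "?b \<le> emeasure lborel (\<Union>i. cbox (z i - r i) (z i + r i))"
      by (intro emeasure_mono) auto
    also have "\<dots> \<le> (\<Sum>i. emeasure lborel (cbox (z i - r i) (z i + r i)))"
      by (intro emeasure_subadditive_countably) auto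
    also have "\<dots> \<le> (\<Sum>i. ennreal K * ennreal (pi / 4 * (diameter (C i))\<^sup>2))"
    proof (intro suminf_le)
      fix i
      let ?d = "diameter (C i)"
      have "(2 * ?d)\<^sup>2 * (2 * ?d + 2 * a) \<le> (2 * ?d)\<^sup>2 * (2 + 2 * a)"
        using C(3)[of i] by (intro mult_left_mono) auto
      also have "\<dots> = K * (pi / 4 * ?d\<^sup>2)" unfolding K_def by (simp add: power2_eq_square)
      finally show "emeasure lborel (cbox (z i - r i) (z i + r i)) \<le> ennreal K * ennreal (pi / 4 * ?d\<^sup>2)"
        unfolding r_def emeasure_thickened_box[OF d0 assms(2)] using K
        by (simp add: ennreal_mult[symmetric] ennreal_leI)
    qed auto
    also have "\<dots> = ennreal K * (\<Sum>i. ennreal (pi / 4 * (diameter (C i))\<^sup>2))" by simp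
    also have "\<dots> \<le> ennreal K * ennreal e" using sum by (intro mult_left_mono) auto
    finally show ?thesis using K that by (simp add: ennreal_mult)
  qed
  moreover have b: "?b = ennreal (measure lborel (ball p \<rho>))"
    using emeasure_lborel_ball_finite[of p \<rho>] by (simp add: emeasure_eq_ennreal_measure)
  moreover have pos: "0 < measure lborel (ball p \<rho>)" using assms(1) by (rule content_ball_pos)
  \<comment> \<open>With this choice \<open>K * e\<close> is half the volume of the ball,
    contradicting the bound.\<close>
  moreover define e where "e = measure lborel (ball p \<rho>) / (2 * K)"
  moreover have "0 < e" unfolding e_def using pos K by simp
  ultimately have "ennreal (measure lborel (ball p \<rho>)) \<le> ennreal (K * e)" by metis
  moreover have "K * e = measure lborel (ball p \<rho>) / 2" using K by (simp add: e_def)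
  ultimately show False using pos by (simp add: ennreal_le_iff)
qed

text \<open>Along a coordinate direction in which the gradient does not vanish,
  \<open>\<phi>\<close> has opposite signs at the two ends of a short segment, and by continuity
  this persists for all parallel segments through a small ball. Each of them meets the surface, so
  the surface sweeps out an open set and cannot be null. No parametrization of the surface is
  involved.\<close>

lemma C1_surface_area_pos:
  assumes \<Gamma>: "C1_surface \<Gamma>" "p \<in> \<Gamma>" and r: "0 < r"
  shows "0 < emeasure surface_area (\<Gamma> \<inter> ball p r)"
proof -
  obtain U \<phi> g where U: "open U" "p \<in> U"
    and \<phi>: "\<And>x. x \<in> U \<Longrightarrow> (\<phi> has_derivative (\<lambda>h. g x \<bullet> h)) (at x)" and g: "g p \<noteq> 0"
    and \<Gamma>U: "\<Gamma> \<inter> U = {x \<in> U. \<phi> x = (0::real)}"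
    using \<Gamma> unfolding C1_surface_def by meson
  have cont: "continuous_on U \<phi>"
    using \<phi> by (meson continuous_at_imp_continuous_on has_derivative_continuous)
  have p0: "\<phi> p = 0" using \<Gamma>U \<Gamma>(2) U(2) by blast
  obtain j where j: "g p $ j \<noteq> 0" using g by (auto simp: vec_eq_iff)
  \<comment> \<open>A coordinate direction, because the sweeping bound uses axis-parallel boxes,
    signed so that \<open>\<phi>\<close> increases along it at \<open>p\<close>.\<close>
  define e where "e = axis j (sgn (g p $ j))"
  have ge: "0 < g p \<bullet> e"
    using j by (simp add: e_def inner_axis sgn_real_def)
  have ne: "norm e = 1" using j by (simp add: e_def norm_eq_1 inner_axis_axis sgn_real_def)
  obtain d1 where d1: "d1 > 0" "\<And>s. s > 0 \<Longrightarrow> s < d1 \<Longrightarrow> 0 < \<phi> (p + s *\<^sub>R e)"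
    using positive_along_direction[OF \<phi>[OF U(2)] p0 ge] by blast
  obtain d2 where d2: "d2 > 0" "\<And>s. s > 0 \<Longrightarrow> s < d2 \<Longrightarrow> \<phi> (p + s *\<^sub>R (- e)) < 0"
    using negative_along_direction[OF \<phi>[OF U(2)] p0, of "- e"] ge by auto
  obtain d3 where d3: "d3 > 0" "ball p d3 \<subseteq> U" using U open_contains_ball by blast
  define R where "R = min r d3"
  have R: "0 < R" "R \<le> r" "R \<le> d3" using r d3 by (auto simp: R_def)
  \<comment> \<open>Half lengths at most \<open>R / 2\<close> and midpoints within
    \<open>R / 2\<close> of \<open>p\<close> keep the segments inside \<open>ball p R\<close>, and
    so inside both \<open>U\<close> and the prescribed ball.\<close>
  define a where "a = min (min d1 d2) R / 2"
  have a: "0 < a" "a < d1" "a < d2" "a \<le> R / 2" using d1 d2 R by (auto simp: a_def)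
  have in_U: "p + h \<in> U" if "norm h < R" for h
    using that R d3 by (auto simp: dist_norm subset_eq)
  have isc: "isCont \<phi> x" if "x \<in> U" for x
    using \<phi>[OF that] by (rule has_derivative_continuous)
  have "isCont (\<lambda>y. \<phi> (y + a *\<^sub>R e)) p" "isCont (\<lambda>y. \<phi> (y + (- a) *\<^sub>R e)) p"
    using a R ne in_U[of "a *\<^sub>R e"] in_U[of "(- a) *\<^sub>R e"]
    by (auto intro!: isCont_o2[of _ _ \<phi>] isc continuous_intros)
  moreover have "0 < \<phi> (p + a *\<^sub>R e)" "\<phi> (p + (- a) *\<^sub>R e) < 0"
    using d1(2)[of a] d2(2)[of a] a by auto
  ultimately have "\<forall>\<^sub>F y in nhds p. 0 < \<phi> (y + a *\<^sub>R e)" "\<forall>\<^sub>F y in nhds p. \<phi> (y + (- a) *\<^sub>R e) < 0"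
    unfolding isCont_def by (auto intro: order_tendstoD simp: tendsto_nhds_iff)
  then have "\<forall>\<^sub>F y in nhds p. 0 < \<phi> (y + a *\<^sub>R e) \<and> \<phi> (y + (- a) *\<^sub>R e) < 0"
    by (rule eventually_conj)
  then obtain \<rho>0 where \<rho>0: "0 < \<rho>0" "\<And>y. dist y p < \<rho>0 \<Longrightarrow> 0 < \<phi> (y + a *\<^sub>R e) \<and> \<phi> (y + (- a) *\<^sub>R e) < 0"
    unfolding eventually_nhds_metric by blast
  define \<rho> where "\<rho> = min \<rho>0 (R / 2)"
  have \<rho>: "0 < \<rho>" "\<rho> \<le> \<rho>0" "\<rho> \<le> R / 2" using \<rho>0 R by (auto simp: \<rho>_def)
  have "\<exists>s. \<bar>s\<bar> \<le> a \<and> y + s *\<^sub>R axis j 1 \<in> \<Gamma> \<inter> ball p r" if y: "y \<in> ball p \<rho>" for y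
  proof -
    have "y + s *\<^sub>R e \<in> ball p R" if "\<bar>s\<bar> \<le> a" for s
    proof -
      have "norm (y + s *\<^sub>R e - p) \<le> norm (y - p) + \<bar>s\<bar>"
        using norm_triangle_ineq[of "y - p" "s *\<^sub>R e"] ne by (simp add: algebra_simps)
      also have "norm (y - p) < \<rho>" using y by (simp add: dist_norm norm_minus_commute)
      finally show ?thesis using that a \<rho> by (simp add: dist_norm norm_minus_commute)
    qed
    then have ball: "y + s *\<^sub>R e \<in> ball p R" if "- a \<le> s" "s \<le> a" for s using that by (simp add: abs_le_iff)
    have inU: "y + s *\<^sub>R e \<in> U" if "- a \<le> s" "s \<le> a" for s
      using ball[OF that] R d3 by (auto simp: subset_eq)
    have "\<exists>s. - a \<le> s \<and> s \<le> a \<and> \<phi> (y + s *\<^sub>R e) = 0"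
    proof (rule IVT')
      show "continuous_on {- a..a} (\<lambda>s. \<phi> (y + s *\<^sub>R e))"
        using inU by (intro continuous_on_compose2[OF cont] continuous_intros) auto
    qed (use \<rho>0(2)[of y] y \<rho> a in \<open>auto simp: dist_commute less_imp_le\<close>)
    then obtain s where s: "- a \<le> s" "s \<le> a" "\<phi> (y + s *\<^sub>R e) = 0" by blast
    then have "y + s *\<^sub>R e \<in> \<Gamma>" using inU \<Gamma>U by blast
    moreover have "y + s *\<^sub>R e \<in> ball p r" using ball[OF s(1,2)] R by auto
    moreover have "s *\<^sub>R e = (s * sgn (g p $ j)) *\<^sub>R axis j 1"
      by (simp add: e_def vec_eq_iff axis_def)
    moreover have "\<bar>s * sgn (g p $ j)\<bar> \<le> a" using s j by (simp add: abs_mult abs_sgn_eq)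
    ultimately show ?thesis by (metis IntI)
  qed
  then have "0 < hausdorff2_outer (\<Gamma> \<inter> ball p r)"
    using hausdorff2_outer_pos[of \<rho> a p j] \<rho> a by simp
  moreover have "\<Gamma> \<inter> ball p r \<in> sets borel" using C1_surface_borel[OF \<Gamma>(1)] by auto
  ultimately show ?thesis by (simp add: emeasure_surface_area)
qed

section \<open>Unique continuation for Maxwell fields\<close>

definition poly_fields :: "nat \<Rightarrow> vector_field set" where
  "poly_fields k = {v. \<forall>i. (\<lambda>x t. v x t $ i) \<in> poly_space k}"

definition pdv :: "3 option \<Rightarrow> vector_field \<Rightarrow> vector_field" where
  "pdv d v x t = (\<chi> i. pd d (\<lambda>x t. v x t $ i) x t)"

lemma poly_fieldsD: "v \<in> poly_fields k \<Longrightarrow> (\<lambda>x t. v x t $ i) \<in> poly_space k"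
  by (simp add: poly_fields_def)

lemma pdv_component: "(\<lambda>x t. pdv d v x t $ i) = pd d (\<lambda>x t. v x t $ i)"
  by (simp add: pdv_def)

lemma pdv_in_poly_fields: "v \<in> poly_fields k \<Longrightarrow> pdv d v \<in> poly_fields (k - 1)"
  unfolding poly_fields_def mem_Collect_eq pdv_component by (intro allI pd_in_poly_space) blast

lemma time_deriv_eq_pdv:
  assumes "v \<in> poly_fields k"
  shows "time_deriv v = pdv None v"
proof (intro ext)
  fix x t
  have "((\<lambda>s. v x s) has_vector_derivative pdv None v x t) (at t)"
    unfolding has_vector_derivative_def
  proof (subst has_derivative_componentwise_within, rule ballI)
    fix b :: "real^3" assume "b \<in> Basis"
    then obtain i where b: "b = axis i 1" by (auto simp: Basis_vec_def)
    show "((\<lambda>s. v x s \<bullet> b) has_derivative (\<lambda>s. (s *\<^sub>R pdv None v x t) \<bullet> b)) (at t)"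
      using poly_has_time_derivative[OF poly_fieldsD[OF assms], of x i t]
      by (simp add: b inner_axis has_field_derivative_def pdv_def mult_commute_abs)
  qed
  then show "time_deriv v x t = pdv None v x t"
    unfolding time_deriv_def by (rule vector_derivative_at)
qed

lemma divergence_eq_pd: "divergence v = (\<Sum>i\<in>UNIV. pd (Some i) (\<lambda>x t. v x t $ i))"
  by (simp add: divergence_def fun_eq_iff pd_def sum_fun_apply)

lemma curl_eq_pd:
  "curl v x t =
     (let d = (\<lambda>i j. pd (Some i) (\<lambda>x t. v x t $ j) x t) in vector [d 2 3 - d 3 2, d 3 1 - d 1 3, d 1 2 - d 2 1])"
  by (simp add: curl_def pd_def)

lemma curl_nth:
  "curl v x t $ 1 = pd (Some 2) (\<lambda>x t. v x t $ 3) x t - pd (Some 3) (\<lambda>x t. v x t $ 2) x t"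
  "curl v x t $ 2 = pd (Some 3) (\<lambda>x t. v x t $ 1) x t - pd (Some 1) (\<lambda>x t. v x t $ 3) x t"
  "curl v x t $ 3 = pd (Some 1) (\<lambda>x t. v x t $ 2) x t - pd (Some 2) (\<lambda>x t. v x t $ 1) x t"
  by (simp_all add: curl_eq_pd Let_def)

lemma curl_components:
  "(\<lambda>x t. curl v x t $ 1) = pd (Some 2) (\<lambda>x t. v x t $ 3) - pd (Some 3) (\<lambda>x t. v x t $ 2)"
  "(\<lambda>x t. curl v x t $ 2) = pd (Some 3) (\<lambda>x t. v x t $ 1) - pd (Some 1) (\<lambda>x t. v x t $ 3)"
  "(\<lambda>x t. curl v x t $ 3) = pd (Some 1) (\<lambda>x t. v x t $ 2) - pd (Some 2) (\<lambda>x t. v x t $ 1)"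
  by (simp_all add: curl_nth fun_eq_iff)

lemma subspace_poly_fields: "subspace (poly_fields k)"
proof (rule subspaceI)
  show "0 \<in> poly_fields k"
    using subspace_0[OF subspace_poly_space] by (simp add: poly_fields_def zero_fun_def)
  show "v + w \<in> poly_fields k" if "v \<in> poly_fields k" "w \<in> poly_fields k" for v w
    using that subspace_add[OF subspace_poly_space] by (simp add: poly_fields_def plus_fun_def)
  show "r *\<^sub>R v \<in> poly_fields k" if "v \<in> poly_fields k" for r v
    using that subspace_scale[OF subspace_poly_space] by (simp add: poly_fields_def scaleR_fun_def)
qed

lemma curl_in_poly_fields: "v \<in> poly_fields k \<Longrightarrow> curl v \<in> poly_fields (k - 1)"
  unfolding poly_fields_def forall_3 mem_Collect_eq curl_components
  by (intro conjI subspace_diff[OF subspace_poly_space] pd_in_poly_space) auto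

lemma pd_diff:
  assumes "p \<in> poly_space k" "q \<in> poly_space k"
  shows "pd d (p - q) x t = pd d p x t - pd d q x t"
  using pd_add[OF assms(1) subspace_scale[OF subspace_poly_space assms(2)], of d "-1" x t]
    pd_scaleR[OF assms(2), of d "-1" x t]
  by simp

lemma pd_sum:
  assumes "\<And>i. i \<in> A \<Longrightarrow> p i \<in> poly_space k"
  shows "pd d (\<Sum>i\<in>A. p i) x t = (\<Sum>i\<in>A. pd d (p i) x t)"
  using assms
proof (induction A rule: infinite_finite_induct)
  case (insert i A)
  have "pd d (p i + (\<Sum>i\<in>A. p i)) x t = pd d (p i) x t + pd d (\<Sum>i\<in>A. p i) x t"
    using insert.prems by (intro pd_add[of _ k] subspace_sum[OF subspace_poly_space]) auto
  moreover have "pd d (\<Sum>i\<in>A. p i) x t = (\<Sum>i\<in>A. pd d (p i) x t)"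
    using insert.IH insert.prems by blast
  ultimately show ?case by (simp only: sum.insert[OF insert.hyps])
next
  case empty
  have "pd d (0 *\<^sub>R 0) x t = 0 * pd d 0 x t"
    using pd_scaleR[OF subspace_0[OF subspace_poly_space]] .
  then show ?case by (simp only: sum.empty scaleR_zero_left mult_zero_left)
next
  case (infinite A)
  have "pd d (0 *\<^sub>R 0) x t = 0 * pd d 0 x t"
    using pd_scaleR[OF subspace_0[OF subspace_poly_space]] .
  then show ?case by (simp only: sum.infinite[OF infinite.hyps] scaleR_zero_left mult_zero_left)
qed

lemma pd_divergence:
  assumes v: "v \<in> poly_fields k"
  shows "pd d (divergence v) = divergence (pdv d v)"
proof (intro ext)
  fix x t
  have "pd d (divergence v) x t = (\<Sum>i\<in>UNIV. pd d (pd (Some i) (\<lambda>x t. v x t $ i)) x t)"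
    unfolding divergence_eq_pd by (intro pd_sum[of _ _ "k - 1"] pd_in_poly_space poly_fieldsD v)
  then show "pd d (divergence v) x t = divergence (pdv d v) x t"
    by (simp add: divergence_eq_pd pdv_component pd_commute[OF poly_fieldsD[OF v], of d] sum_fun_apply)
qed

lemma pdv_curl:
  assumes v: "v \<in> poly_fields k"
  shows "pdv d (curl v) = curl (pdv d v)"
proof (intro ext)
  fix x t
  have m: "pd e (\<lambda>x t. v x t $ i) \<in> poly_space (k - 1)" for e i
    by (intro pd_in_poly_space poly_fieldsD v)
  have "pdv d (curl v) x t $ i = pd d (\<lambda>x t. curl v x t $ i) x t" for i
    by (simp add: pdv_def)
  then show "pdv d (curl v) x t = curl (pdv d v) x t"
    unfolding vec_eq_iff forall_3
    by (simp only: curl_components curl_nth[of "pdv d v"] pd_diff[OF m m] pdv_component minus_apply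
        pd_commute[OF poly_fieldsD[OF v], of d])
qed

lemma pdv_add:
  assumes "v \<in> poly_fields k" "w \<in> poly_fields k"
  shows "pdv d (v + w) x t = pdv d v x t + pdv d w x t"
  using pd_add[OF poly_fieldsD[OF assms(1)] poly_fieldsD[OF assms(2)]]
  by (simp add: pdv_def vec_eq_iff plus_fun_def)

lemma pdv_scaleR:
  assumes "v \<in> poly_fields k"
  shows "pdv d (r *\<^sub>R v) x t = r *\<^sub>R pdv d v x t"
  using pd_scaleR[OF poly_fieldsD[OF assms]]
  by (simp add: pdv_def vec_eq_iff scaleR_fun_def)

lemma divergence_add:
  assumes "v \<in> poly_fields k" "w \<in> poly_fields k"
  shows "divergence (v + w) x t = divergence v x t + divergence w x t"
  using pd_add[OF poly_fieldsD[OF assms(1)] poly_fieldsD[OF assms(2)]]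
  by (simp add: divergence_eq_pd plus_fun_def sum_fun_apply sum.distrib)

lemma divergence_scaleR:
  assumes "v \<in> poly_fields k"
  shows "divergence (r *\<^sub>R v) x t = r * divergence v x t"
  using pd_scaleR[OF poly_fieldsD[OF assms]]
  by (simp add: divergence_eq_pd scaleR_fun_def sum_fun_apply sum_distrib_left)

lemma curl_add:
  assumes "v \<in> poly_fields k" "w \<in> poly_fields k"
  shows "curl (v + w) x t = curl v x t + curl w x t"
  using pd_add[OF poly_fieldsD[OF assms(1)] poly_fieldsD[OF assms(2)]]
  by (simp add: curl_eq_pd plus_fun_def Let_def vec_eq_iff forall_3)

lemma curl_scaleR:
  assumes "v \<in> poly_fields k"
  shows "curl (r *\<^sub>R v) x t = r *\<^sub>R curl v x t"
  using pd_scaleR[OF poly_fieldsD[OF assms]]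
  by (simp add: curl_eq_pd scaleR_fun_def Let_def vec_eq_iff forall_3 right_diff_distrib)

text \<open>Allows differentiating an identity that is known only on \<open>W \<times> T\<close>:
  openness provides a neighbourhood in the direction of the derivative, and \<open>p\<close> itself
  need not be a polynomial.\<close>

lemma pd_eq_0_on_open:
  assumes W: "open W" "x \<in> W" and T: "open T" "t \<in> T"
    and zero: "\<And>x t. x \<in> W \<Longrightarrow> t \<in> T \<Longrightarrow> p x t = 0"
  shows "pd d p x t = 0"
proof (cases d)
  case None
  have "\<forall>\<^sub>F s in nhds t. p x s = 0"
    using eventually_nhds_in_open[OF T] by eventually_elim (use zero W in auto)
  then have "deriv (\<lambda>s. p x s) t = deriv (\<lambda>s. 0) t"
    by (intro deriv_cong_ev) auto
  then show ?thesis using None by (simp add: pd_def)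
next
  case (Some i)
  have "isCont (\<lambda>s. x + s *\<^sub>R axis i 1) 0" by (intro continuous_intros)
  then have "\<forall>\<^sub>F s in nhds 0. x + s *\<^sub>R axis i 1 \<in> W"
    using W by (intro topological_tendstoD[of _ x]) (auto simp: isCont_def tendsto_nhds_iff)
  then have "\<forall>\<^sub>F s in nhds 0. p (x + s *\<^sub>R axis i 1) t = 0"
    by eventually_elim (use zero T in auto)
  then have "deriv (\<lambda>s. p (x + s *\<^sub>R axis i 1) t) 0 = deriv (\<lambda>s. 0) 0"
    by (intro deriv_cong_ev) auto
  then show ?thesis using Some by (simp add: pd_def partial_space_def)
qed

lemma pdv_eq_0_on_open:
  assumes "open W" "x \<in> W" "open T" "t \<in> T"
    and "\<And>x t. x \<in> W \<Longrightarrow> t \<in> T \<Longrightarrow> v x t = 0"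
  shows "pdv d v x t = 0"
  unfolding pdv_def using assms by (simp add: vec_eq_iff pd_eq_0_on_open[of W x T t])

section \<open>The Maxwell system with fields vanishing on a surface\<close>

definition maxwell_on :: "real \<Rightarrow> real \<Rightarrow> (real^3) set \<Rightarrow> real set \<Rightarrow> vector_field \<Rightarrow> vector_field \<Rightarrow> bool" where
  "maxwell_on \<mu> \<epsilon> W T H E \<longleftrightarrow> (\<forall>x\<in>W. \<forall>t\<in>T.
     divergence H x t = 0 \<and> divergence E x t = 0 \<and>
     \<mu> *\<^sub>R time_deriv H x t + curl E x t = 0 \<and> \<epsilon> *\<^sub>R time_deriv E x t - curl H x t = 0)"

text \<open>The system has constant coefficients, so differentiation in any space-time direction
  commutes with it.\<close>

lemma maxwell_on_pdv:
  assumes W: "open W" and T: "open T" and H: "H \<in> poly_fields k" and E: "E \<in> poly_fields k"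
    and M: "maxwell_on \<mu> \<epsilon> W T H E"
  shows "maxwell_on \<mu> \<epsilon> W T (pdv d H) (pdv d E)"
  unfolding maxwell_on_def
proof (intro ballI conjI)
  fix x t assume x: "x \<in> W" and t: "t \<in> T"
  note zero = pd_eq_0_on_open[OF W x T t] pdv_eq_0_on_open[OF W x T t]
  show "divergence (pdv d H) x t = 0" "divergence (pdv d E) x t = 0"
    unfolding pd_divergence[OF H, symmetric] pd_divergence[OF E, symmetric]
    using M unfolding maxwell_on_def by (intro zero; simp)+
  \<comment> \<open>Both evolution equations have this shape, with coefficients
    \<open>\<mu>\<close>, 1 and \<open>\<epsilon>\<close>, -1.\<close>
  have comm: "pdv d (r *\<^sub>R time_deriv u + s *\<^sub>R curl v) x t
      = r *\<^sub>R time_deriv (pdv d u) x t + s *\<^sub>R curl (pdv d v) x t"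
    if u: "u \<in> poly_fields k" and v: "v \<in> poly_fields k" for r s u v
  proof -
    have m: "pdv None u \<in> poly_fields (k - 1)" "curl v \<in> poly_fields (k - 1)"
      by (rule pdv_in_poly_fields[OF u], rule curl_in_poly_fields[OF v])
    have "pdv d (pdv None u) = pdv None (pdv d u)"
      using pd_commute[OF poly_fieldsD[OF u], of d None] unfolding pdv_def[of d "pdv None u"] pdv_def[of None "pdv d u"]
      by (simp add: fun_eq_iff pdv_component)
    then show ?thesis
      using pdv_add[OF subspace_scale[OF subspace_poly_fields m(1)] subspace_scale[OF subspace_poly_fields m(2)], of d r s x t]
        time_deriv_eq_pdv[OF u] time_deriv_eq_pdv[OF pdv_in_poly_fields[OF u, of d]]
      by (simp add: pdv_scaleR[OF m(1)] pdv_scaleR[OF m(2)] pdv_curl[OF v])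
  qed
  have "pdv d (\<mu> *\<^sub>R time_deriv H + 1 *\<^sub>R curl E) x t = 0"
    using M unfolding maxwell_on_def by (intro zero) simp
  then show "\<mu> *\<^sub>R time_deriv (pdv d H) x t + curl (pdv d E) x t = 0"
    unfolding comm[OF H E] by simp
  have "pdv d (\<epsilon> *\<^sub>R time_deriv E + (- 1) *\<^sub>R curl H) x t = 0"
    using M unfolding maxwell_on_def by (intro zero) simp
  then show "\<epsilon> *\<^sub>R time_deriv (pdv d E) x t - curl (pdv d H) x t = 0"
    unfolding comm[OF E H] by simp
qed

lemma parallel_if_orthogonal_complement:
  fixes a G :: "'a::real_inner"
  assumes "G \<noteq> 0" "\<And>v. G \<bullet> v = 0 \<Longrightarrow> a \<bullet> v = 0"
  shows "\<exists>r. a = r *\<^sub>R G"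
proof -
  define r where "r = (a \<bullet> G) / (G \<bullet> G)"
  have v: "G \<bullet> (a - r *\<^sub>R G) = 0"
    using assms(1) by (simp add: r_def inner_diff_right inner_commute)
  from assms(2)[OF this] v have "(a - r *\<^sub>R G) \<bullet> (a - r *\<^sub>R G) = 0"
    by (simp add: inner_diff_left)
  then show ?thesis by auto
qed

text \<open>The spatial gradient of each component annihilates the tangent directions, so it is a
  multiple of the chart gradient \<open>g\<close>, and the Jacobian has rank at most one. Curl and
  divergence thereby reduce to their symbols at \<open>g\<close>. The time \<open>t\<close> is fixed
  throughout.\<close>

lemma derivatives_on_zero_surface:
  assumes \<Gamma>: "C1_surface \<Gamma>" and W: "open W" and q: "q \<in> \<Gamma>" "q \<in> W"
    and v: "v \<in> poly_fields k" and zero: "\<And>x. x \<in> \<Gamma> \<Longrightarrow> x \<in> W \<Longrightarrow> v x t = 0"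
  shows "\<exists>g w. g \<noteq> 0 \<and> curl v q t = cross3 g w \<and> divergence v q t = g \<bullet> w \<and>
           (\<forall>i. pdv (Some i) v q t = g $ i *\<^sub>R w)"
proof -
  obtain U \<phi> g where U: "open U" "q \<in> U"
    and \<phi>: "\<And>x. x \<in> U \<Longrightarrow> (\<phi> has_derivative (\<lambda>h. g x \<bullet> h)) (at x)" and g: "g q \<noteq> 0"
    and \<Gamma>U: "\<Gamma> \<inter> U = {x \<in> U. \<phi> x = (0::real)}"
    using \<Gamma> q(1) unfolding C1_surface_def by meson
  have cont: "continuous_on (U \<inter> W) \<phi>"
    using \<phi> by (meson IntD1 continuous_at_imp_continuous_on has_derivative_continuous)
  have "\<exists>r. (\<chi> i. pd (Some i) (\<lambda>x t. v x t $ j) q t) = r *\<^sub>R g q" for j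
  proof (rule parallel_if_orthogonal_complement[OF g])
    fix h :: "real^3" assume h: "g q \<bullet> h = 0"
    have "(\<Sum>i\<in>UNIV. h $ i * pd (Some i) (\<lambda>x t. v x t $ j) q t) = 0"
    proof (rule tangential_derivative_eq_0[where v = h and f = "\<lambda>x. v x t $ j"
          and f' = "\<lambda>h. \<Sum>i\<in>UNIV. h $ i * pd (Some i) (\<lambda>x t. v x t $ j) q t", OF _ _ cont])
      show "(\<phi> has_derivative (\<lambda>h. g q \<bullet> h)) (at q)" using \<phi> U by blast
      show "((\<lambda>x. v x t $ j) has_derivative
          (\<lambda>h. \<Sum>i\<in>UNIV. h $ i * pd (Some i) (\<lambda>x t. v x t $ j) q t)) (at q)"
        by (rule poly_has_derivative[OF poly_fieldsD[OF v]])
      show "v x t $ j = 0" if "x \<in> U \<inter> W" "\<phi> x = 0" for x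
      proof -
        have "x \<in> \<Gamma> \<inter> U" using that unfolding \<Gamma>U by simp
        then show ?thesis using zero[of x] that by simp
      qed
      have "q \<in> {x \<in> U. \<phi> x = 0}" using q(1) U(2) \<Gamma>U by blast
      then show "\<phi> q = 0" by simp
    qed (use U W q g h in auto)
    then show "(\<chi> i. pd (Some i) (\<lambda>x t. v x t $ j) q t) \<bullet> h = 0"
      by (simp add: inner_vec_def mult.commute)
  qed
  then obtain r where r: "\<And>j. (\<chi> i. pd (Some i) (\<lambda>x t. v x t $ j) q t) = r j *\<^sub>R g q" by metis
  have d: "pd (Some i) (\<lambda>x t. v x t $ j) q t = g q $ i * r j" for i j
    using arg_cong[OF r[of j], of "\<lambda>a. a $ i"] by simp
  show ?thesis
  proof (intro exI conjI allI)
    show "curl v q t = cross3 (g q) (\<chi> j. r j)"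
      by (simp add: curl_eq_pd d cross3_def Let_def)
    show "divergence v q t = g q \<bullet> (\<chi> j. r j)"
      by (simp add: divergence_eq_pd sum_fun_apply d inner_vec_def)
    show "pdv (Some i) v q t = g q $ i *\<^sub>R (\<chi> j. r j)" for i
      by (simp add: pdv_def d vec_eq_iff)
  qed (fact g)
qed

text \<open>Serves twice: with the unit normal for the values of the fields, and with the chart
  gradient for their normal derivatives.\<close>

lemma eq_0_if_cross_and_inner_eq_0:
  assumes "g \<noteq> 0" "cross3 g w = 0" "g \<bullet> w = 0"
  shows "w = 0"
  using norm_cross_dot[of g w] assms by simp

text \<open>The conclusion reaches all of space-time although the equations hold only on
  \<open>W \<times> T\<close>: the induction makes every first derivative vanish identically, so the
  fields are constant, and the constant is read off at \<open>c\<close> and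
  \<open>t0\<close>.\<close>

lemma maxwell_unique_continuation:
  assumes \<mu>\<epsilon>: "\<mu> \<noteq> 0" "\<epsilon> \<noteq> 0" and \<Gamma>: "C1_surface \<Gamma>" and W: "open W" and T: "open T"
    and c: "c \<in> \<Gamma>" "c \<in> W" and t0: "t0 \<in> T"
    and H: "H \<in> poly_fields k" and E: "E \<in> poly_fields k"
    and M: "maxwell_on \<mu> \<epsilon> W T H E"
    and zero: "\<And>x t. x \<in> \<Gamma> \<Longrightarrow> x \<in> W \<Longrightarrow> t \<in> T \<Longrightarrow> H x t = 0 \<and> E x t = 0"
  shows "H x t = 0 \<and> E x t = 0"
  using H E M zero
proof (induction k arbitrary: H E x t)
  case 0
  have "H x t $ i = H c t0 $ i" "E x t $ i = E c t0 $ i" for i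
    using poly_space_0_constant[OF poly_fieldsD[OF "0.prems"(1)]]
      poly_space_0_constant[OF poly_fieldsD[OF "0.prems"(2)]] by blast+
  then show ?case using "0.prems"(4)[OF c t0] by (simp add: vec_eq_iff)
next
  case (Suc k)
  note H = Suc.prems(1) and E = Suc.prems(2) and M = Suc.prems(3) and zero = Suc.prems(4)
  \<comment> \<open>The surface does not move, so a field vanishing on it vanishes at
    \<open>q\<close> for all times near \<open>s\<close>, and time derivatives cost nothing.\<close>
  have td: "pdv None v q s = 0"
    if "q \<in> \<Gamma>" "q \<in> W" "s \<in> T" "\<And>s. s \<in> T \<Longrightarrow> v q s = 0" "v \<in> poly_fields (Suc k)" for v q s
  proof -
    have "\<forall>\<^sub>F s in nhds s. v q s = 0"
      using eventually_nhds_in_open[OF T \<open>s \<in> T\<close>] by eventually_elim (use that in auto)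
    then have "\<forall>\<^sub>F s in nhds s. v q s $ i = 0" for i
      by eventually_elim simp
    then have "deriv (\<lambda>s. v q s $ i) s = deriv (\<lambda>s. 0) s" for i
      by (intro deriv_cong_ev) auto
    then show ?thesis by (simp add: pdv_def pd_def vec_eq_iff)
  qed
  \<comment> \<open>This supplies the vanishing data on the surface that the induction hypothesis
    requires of the differentiated fields.\<close>
  have der: "pdv d H q s = 0 \<and> pdv d E q s = 0" if q: "q \<in> \<Gamma>" "q \<in> W" and s: "s \<in> T" for d q s
  proof -
    have tH: "pdv None H q s = 0" and tE: "pdv None E q s = 0"
      using td q s H E zero by blast+
    have "curl H q s = 0" "curl E q s = 0" "divergence H q s = 0" "divergence E q s = 0"
      using M q s tH tE unfolding maxwell_on_def time_deriv_eq_pdv[OF H] time_deriv_eq_pdv[OF E] by force+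
    moreover have "v = H \<or> v = E \<Longrightarrow> curl v q s = 0 \<Longrightarrow> divergence v q s = 0 \<Longrightarrow> pdv (Some i) v q s = 0" for v i
      using derivatives_on_zero_surface[OF \<Gamma> W q, of v "Suc k" s] H E zero s eq_0_if_cross_and_inner_eq_0
      by (metis scaleR_zero_right)
    ultimately show ?thesis using tH tE by (cases d) auto
  qed
  have IH: "pdv d H x t = 0 \<and> pdv d E x t = 0" for d x t
  proof (rule Suc.IH[of "pdv d H" "pdv d E"])
    show "pdv d H \<in> poly_fields k" "pdv d E \<in> poly_fields k"
      using pdv_in_poly_fields[OF H] pdv_in_poly_fields[OF E] by simp_all
    show "maxwell_on \<mu> \<epsilon> W T (pdv d H) (pdv d E)"
      by (rule maxwell_on_pdv[OF W T H E M])
  qed (use der in blast)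
  have const: "v x t = v c t0" if "v \<in> poly_fields (Suc k)" "\<And>d x t. pdv d v x t = 0" for v
    using poly_constant[OF poly_fieldsD[OF that(1)], of _ x t c t0] that(2)
    by (simp add: pdv_def vec_eq_iff)
  show ?case
    using const[OF H] const[OF E] IH zero[OF c t0] by simp
qed

section \<open>Space-time integrals\<close>

text \<open>One construction for both kinds of terms: \<open>N\<close> is \<open>lborel\<close> for
  the field equations and \<open>surface_area\<close> for the interface conditions.\<close>

definition spacetime_measure :: "(real^3) measure \<Rightarrow> (real^3) set \<Rightarrow> real set \<Rightarrow> ((real^3) \<times> real) measure" where
  "spacetime_measure N S I = restrict_space N S \<Otimes>\<^sub>M restrict_space lborel I"

definition finite_patch :: "(real^3) measure \<Rightarrow> (real^3) set \<Rightarrow> real set \<Rightarrow> bool" where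
  "finite_patch N S I \<longleftrightarrow> sets N = sets borel \<and> S \<in> sets borel \<and> emeasure N S < \<infinity> \<and> compact I"

lemma finite_measure_restrict_space_borel:
  assumes "sets N = sets borel" "S \<in> sets borel" "emeasure N S < \<infinity>"
  shows "finite_measure (restrict_space N S)"
proof
  have "space N = UNIV" using sets_eq_imp_space_eq[OF assms(1)] by simp
  then show "emeasure (restrict_space N S) (space (restrict_space N S)) \<noteq> \<infinity>"
    using assms by (simp add: space_restrict_space emeasure_restrict_space)
qed

lemma finite_patchD:
  assumes "finite_patch N S I"
  shows "finite_measure (restrict_space N S)" "finite_measure (restrict_space lborel I)"
    "space (spacetime_measure N S I) = S \<times> I" "space N = UNIV" "I \<in> sets borel"
proof -
  show I: "I \<in> sets borel" using assms by (simp add: finite_patch_def borel_compact)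
  show N: "space N = UNIV"
    using assms sets_eq_imp_space_eq[of N borel] by (simp add: finite_patch_def)
  show "finite_measure (restrict_space N S)"
    using assms by (intro finite_measure_restrict_space_borel) (auto simp: finite_patch_def)
  have "emeasure lborel I < \<infinity>"
    using assms by (intro emeasure_compact_finite) (auto simp: finite_patch_def)
  then show "finite_measure (restrict_space lborel I)"
    using I by (auto intro!: finite_measureI simp: space_restrict_space emeasure_restrict_space)
  show "space (spacetime_measure N S I) = S \<times> I"
    by (simp add: spacetime_measure_def space_pair_measure space_restrict_space N)
qed

lemma finite_measure_spacetime: "finite_patch N S I \<Longrightarrow> finite_measure (spacetime_measure N S I)"
  unfolding spacetime_measure_def using finite_patchD by (blast intro: finite_measure_pair_measure)

text \<open>Connects the inner products, which are iterated integrals with time outermost, to square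
  integrability over the product measure. Finiteness of the restricted measures supplies the
  sigma-finiteness for Fubini's theorem.\<close>

lemma iterated_integral_eq:
  fixes f :: "real^3 \<Rightarrow> real \<Rightarrow> real"
  assumes P: "finite_patch N S I" and f: "integrable (spacetime_measure N S I) (\<lambda>(x, t). f x t)"
  shows "(LINT t:I|lborel. (LINT x:S|N. f x t)) = (\<integral>(x, t). f x t \<partial>spacetime_measure N S I)"
proof -
  note D = finite_patchD[OF P]
  interpret A: finite_measure "restrict_space N S" by (rule D)
  interpret B: finite_measure "restrict_space lborel I" by (rule D)
  interpret pair_sigma_finite "restrict_space N S" "restrict_space lborel I" ..
  have S: "S \<inter> space N \<in> sets N" using P by (simp add: D finite_patch_def)
  have "(LINT t:I|lborel. (LINT x:S|N. f x t))
      = (\<integral>t. (\<integral>x. f x t \<partial>restrict_space N S) \<partial>restrict_space lborel I)"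
    unfolding set_lebesgue_integral_def using D(5) by (simp add: integral_restrict_space S)
  also have "\<dots> = (\<integral>(x, t). f x t \<partial>spacetime_measure N S I)"
    unfolding spacetime_measure_def
    by (rule integral_snd) (use f in \<open>simp add: spacetime_measure_def\<close>)
  finally show ?thesis .
qed

lemma quadratic_on_cong:
  assumes "quadratic_on S a J" "\<And>x. x \<in> S \<Longrightarrow> K x = J x"
  shows "quadratic_on S a K"
  using assms unfolding quadratic_on_def by simp

text \<open>Each of the six terms of the functional is an instance: \<open>A\<close> is the linear
  part of the residual and \<open>b\<close> the prescribed data, possibly zero.\<close>

lemma quadratic_on_iterated_integral:
  fixes A :: "'v::real_vector \<Rightarrow> real^3 \<Rightarrow> real \<Rightarrow> 'b::euclidean_space"
  assumes P: "finite_patch N S I" and V: "subspace V"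
    and A: "\<And>D. D \<in> V \<Longrightarrow> sq_integrable (spacetime_measure N S I) (\<lambda>(x, t). A D x t)"
    and b: "sq_integrable (spacetime_measure N S I) (\<lambda>(x, t). b x t)"
    and add: "\<And>D D' x t. D \<in> V \<Longrightarrow> D' \<in> V \<Longrightarrow> A (D + D') x t = A D x t + A D' x t"
    and scale: "\<And>D r x t. D \<in> V \<Longrightarrow> A (r *\<^sub>R D) x t = r *\<^sub>R A D x t"
  shows "quadratic_on V (\<lambda>D D'. \<integral>(x, t). A D x t \<bullet> A D' x t \<partial>spacetime_measure N S I)
           (\<lambda>D. LINT t:I|lborel. (LINT x:S|N. (A D x t - b x t) \<bullet> (A D x t - b x t)))"
proof (rule quadratic_on_cong)
  let ?M = "spacetime_measure N S I"
  let ?A = "\<lambda>D (x, t). A D x t" and ?b = "\<lambda>(x, t). b x t"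
  have "quadratic_on V (\<lambda>D D'. \<integral>z. ?A D z \<bullet> ?A D' z \<partial>?M) (\<lambda>D. \<integral>z. (?A D z - ?b z) \<bullet> (?A D z - ?b z) \<partial>?M)"
    by (rule quadratic_on_square_integral[OF V]) (use A b in \<open>auto simp: add scale split_def\<close>)
  then show "quadratic_on V (\<lambda>D D'. \<integral>(x, t). A D x t \<bullet> A D' x t \<partial>?M)
      (\<lambda>D. \<integral>(x, t). (A D x t - b x t) \<bullet> (A D x t - b x t) \<partial>?M)"
    by (simp add: split_def)
  fix D assume "D \<in> V"
  then have d: "sq_integrable ?M (\<lambda>z. ?A D z - ?b z)" by (intro sq_integrable_diff A b)
  show "(LINT t:I|lborel. (LINT x:S|N. (A D x t - b x t) \<bullet> (A D x t - b x t)))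
      = (\<integral>(x, t). (A D x t - b x t) \<bullet> (A D x t - b x t) \<partial>?M)"
    using sq_integrable_inner[OF d d] by (intro iterated_integral_eq P) (simp add: split_def)
qed

section \<open>Square integrability of the residuals\<close>

lemma sq_integrable_bounded:
  assumes "finite_measure M" "f \<in> borel_measurable M" "\<And>z. z \<in> space M \<Longrightarrow> norm (f z) \<le> B"
  shows "sq_integrable M f"
proof -
  interpret finite_measure M by fact
  have "integrable M (\<lambda>z. (norm (f z))\<^sup>2)"
  proof (rule integrable_const_bound[of _ "B\<^sup>2"])
    show "AE z in M. norm ((norm (f z))\<^sup>2) \<le> B\<^sup>2"
      using assms(3) by (intro AE_I2) (simp add: power_mono)
  qed (use assms(2) in measurable)
  then show ?thesis using assms(2) by (simp add: sq_integrable_def)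
qed

lemma measurable_continuous_spacetime:
  assumes P: "finite_patch N S I" and f: "continuous_on UNIV (\<lambda>z. f (fst z) (snd z))"
  shows "(\<lambda>(x, t). f x t) \<in> borel_measurable (spacetime_measure N S I)"
proof -
  have "(\<lambda>x. x) \<in> measurable (restrict_space N S) borel"
    using P by (intro measurable_restrict_space1 measurable_ident_sets) (simp add: finite_patch_def)
  moreover have "(\<lambda>t. t) \<in> measurable (restrict_space lborel I) borel"
    by (intro measurable_restrict_space1 measurable_ident_sets) simp
  ultimately have "(\<lambda>z. (fst z, snd z)) \<in> measurable (spacetime_measure N S I) (borel \<Otimes>\<^sub>M borel)"
    unfolding spacetime_measure_def
    by (intro measurable_Pair measurable_compose[OF measurable_fst] measurable_compose[OF measurable_snd])
  then have "(\<lambda>z. z) \<in> measurable (spacetime_measure N S I) borel"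
    by (simp add: borel_prod)
  from measurable_compose[OF this borel_measurable_continuous_onI[OF f]]
  show ?thesis by (simp add: split_def)
qed

lemma continuous_bounded_on_compact:
  fixes f :: "real^3 \<Rightarrow> real \<Rightarrow> 'b::real_normed_vector"
  assumes "compact \<Omega>" "compact I" and f: "continuous_on UNIV (\<lambda>z. f (fst z) (snd z))"
  obtains B where "\<And>x t. x \<in> \<Omega> \<Longrightarrow> t \<in> I \<Longrightarrow> norm (f x t) \<le> B"
proof -
  have "compact ((\<lambda>z. f (fst z) (snd z)) ` (\<Omega> \<times> I))"
    using assms by (intro compact_continuous_image compact_Times) (auto intro: continuous_on_subset)
  then have "bounded ((\<lambda>z. f (fst z) (snd z)) ` (\<Omega> \<times> I))" by (rule compact_imp_bounded)
  then obtain B where "\<forall>y\<in>(\<lambda>z. f (fst z) (snd z)) ` (\<Omega> \<times> I). norm y \<le> B"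
    unfolding bounded_iff by blast
  then show ?thesis by (intro that[of B]) force
qed

lemma sq_integrable_continuous:
  assumes P: "finite_patch N S I" and \<Omega>: "S \<subseteq> \<Omega>" "compact \<Omega>"
    and f: "continuous_on UNIV (\<lambda>z. f (fst z) (snd z))"
  shows "sq_integrable (spacetime_measure N S I) (\<lambda>(x, t). f x t)"
proof -
  have "compact I" using P by (simp add: finite_patch_def)
  from continuous_bounded_on_compact[OF \<Omega>(2) this f] obtain B
    where B: "\<And>x t. x \<in> \<Omega> \<Longrightarrow> t \<in> I \<Longrightarrow> norm (f x t) \<le> B" by blast
  show ?thesis
    by (rule sq_integrable_bounded[OF finite_measure_spacetime[OF P] measurable_continuous_spacetime[OF P f], of B])
      (use B \<Omega> in \<open>auto simp: finite_patchD[OF P]\<close>)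
qed

lemma poly_field_continuous:
  assumes "v \<in> poly_fields k"
  shows "continuous_on UNIV (\<lambda>z. v (fst z) (snd z))"
proof -
  have "continuous_on UNIV (\<lambda>z. \<chi> i. v (fst z) (snd z) $ i)"
    by (intro continuous_on_vec_lambda poly_continuous[OF poly_fieldsD[OF assms]])
  then show ?thesis by simp
qed

lemma norm_cross3_unit_le:
  assumes "norm n = 1"
  shows "norm (cross3 n v) \<le> norm v"
proof (rule power2_le_imp_le)
  show "(norm (cross3 n v))\<^sup>2 \<le> (norm v)\<^sup>2"
    using norm_cross_dot[of n v] assms by (metis le_add_same_cancel1 mult_1 zero_le_power2)
qed simp

text \<open>The part of the surface in the patch need not be compact, so \<open>v\<close> is bounded
  on the compact \<open>\<Omega>\<close> instead. The normal is controlled only on \<open>S\<close>,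
  hence its measurability is taken in the restricted Borel algebra.\<close>

lemma sq_integrable_normal_parts:
  assumes P: "finite_patch N S I" and \<Omega>: "S \<subseteq> \<Omega>" "compact \<Omega>"
    and n: "continuous_on S n" "\<And>x. x \<in> S \<Longrightarrow> norm (n x) = 1" and v: "v \<in> poly_fields k"
  shows "sq_integrable (spacetime_measure N S I) (\<lambda>(x, t). cross3 (n x) (v x t))"
    and "sq_integrable (spacetime_measure N S I) (\<lambda>(x, t). n x \<bullet> v x t)"
proof -
  let ?M = "spacetime_measure N S I"
  have I: "compact I" using P by (simp add: finite_patch_def)
  from continuous_bounded_on_compact[OF \<Omega>(2) I poly_field_continuous[OF v]] obtain B
    where B: "\<And>x t. x \<in> \<Omega> \<Longrightarrow> t \<in> I \<Longrightarrow> norm (v x t) \<le> B" by blast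
  have "n \<in> borel_measurable (restrict_space borel S)"
    by (rule borel_measurable_continuous_on_restrict[OF n(1)])
  moreover have "sets (restrict_space borel S) = sets (restrict_space N S)"
    using P by (intro sets_restrict_space_cong) (simp add: finite_patch_def)
  ultimately have "n \<in> borel_measurable (restrict_space N S)"
    by (simp cong: measurable_cong_sets)
  then have nm: "(\<lambda>z. n (fst z)) \<in> borel_measurable ?M"
    unfolding spacetime_measure_def by (rule measurable_compose[OF measurable_fst])
  have vm: "(\<lambda>z. v (fst z) (snd z)) \<in> borel_measurable ?M"
    using measurable_continuous_spacetime[OF P poly_field_continuous[OF v]] by (simp add: split_def)
  have "continuous_on UNIV (\<lambda>z::(real^3) \<times> (real^3). cross3 (fst z) (snd z))"
    by (intro continuous_on_cross continuous_intros)
  then have "(\<lambda>z. cross3 (n (fst z)) (v (fst z) (snd z))) \<in> borel_measurable ?M"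
    using borel_measurable_continuous_Pair[OF nm vm, of cross3] by simp
  moreover have "norm (cross3 (n x) (v x t)) \<le> B" if "x \<in> S" "t \<in> I" for x t
    using norm_cross3_unit_le[OF n(2)[OF that(1)]] B[of x t] \<Omega> that by (meson order_trans subsetD)
  ultimately show "sq_integrable ?M (\<lambda>(x, t). cross3 (n x) (v x t))"
    by (intro sq_integrable_bounded[OF finite_measure_spacetime[OF P], of _ B])
      (auto simp: finite_patchD[OF P] split_def)
  have "\<bar>n x \<bullet> v x t\<bar> \<le> norm (v x t)" if "x \<in> S" for x t
    using Cauchy_Schwarz_ineq2[of "n x" "v x t"] n(2)[OF that] by simp
  then have "norm (n x \<bullet> v x t) \<le> B" if "x \<in> S" "t \<in> I" for x t
    using B[of x t] \<Omega> that by (metis order_trans real_norm_def subsetD)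
  then show "sq_integrable ?M (\<lambda>(x, t). n x \<bullet> v x t)"
    using nm vm
    by (intro sq_integrable_bounded[OF finite_measure_spacetime[OF P], of _ B])
      (auto simp: finite_patchD[OF P] split_def)
qed

text \<open>The last two hypotheses put \<open>x\<close> and \<open>t\<close> in the supports of the
  two measures. A nonzero value would persist on an open rectangle around \<open>(x, t)\<close>,
  whose trace on \<open>S \<times> I\<close> has positive product measure.\<close>

lemma continuous_eq_0_if_AE:
  fixes f :: "real^3 \<Rightarrow> real \<Rightarrow> 'b::real_normed_vector"
  assumes P: "finite_patch N S I" and f: "continuous_on UNIV (\<lambda>z. f (fst z) (snd z))"
    and AE: "AE (x, t) in spacetime_measure N S I. f x t = 0"
    and x: "\<And>r. 0 < r \<Longrightarrow> 0 < emeasure N (S \<inter> ball x r)"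
    and t: "\<And>r. 0 < r \<Longrightarrow> 0 < emeasure lborel (I \<inter> ball t r)"
  shows "f x t = 0"
proof (rule ccontr)
  assume ne: "f x t \<noteq> 0"
  let ?M = "spacetime_measure N S I"
  have "open ((\<lambda>z. f (fst z) (snd z)) -` (- {0}))"
    using f by (intro open_vimage) auto
  moreover have "(x, t) \<in> (\<lambda>z. f (fst z) (snd z)) -` (- {0})" using ne by simp
  ultimately obtain X T where XT: "open X" "open T" "x \<in> X" "t \<in> T"
    "X \<times> T \<subseteq> (\<lambda>z. f (fst z) (snd z)) -` (- {0})"
    by (rule open_prod_elim) auto
  obtain r where r: "0 < r" "ball x r \<subseteq> X" using XT open_contains_ball by blast
  obtain s where s: "0 < s" "ball t s \<subseteq> T" using XT open_contains_ball by blast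
  have fN: "sets N = sets borel" "S \<in> sets borel" using P by (auto simp: finite_patch_def)
  note D = finite_patchD[OF P]
  interpret B: finite_measure "restrict_space lborel I" by (rule D)
  have mX: "S \<inter> ball x r \<in> sets (restrict_space N S)" using fN
    by (auto simp: sets_restrict_space)
  have mT: "I \<inter> ball t s \<in> sets (restrict_space lborel I)"
    by (auto simp: sets_restrict_space)
  have "emeasure ?M ((S \<inter> ball x r) \<times> (I \<inter> ball t s)) = emeasure N (S \<inter> ball x r) * emeasure lborel (I \<inter> ball t s)"
    unfolding spacetime_measure_def using fN D
    by (simp add: B.emeasure_pair_measure_Times[OF mX mT] emeasure_restrict_space)
  then have pos: "0 < emeasure ?M ((S \<inter> ball x r) \<times> (I \<inter> ball t s))"
    using x[OF r(1)] t[OF s(1)] by (simp add: ennreal_zero_less_mult_iff)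
  obtain Z where Z: "{z \<in> space ?M. \<not> (case z of (x, t) \<Rightarrow> f x t = 0)} \<subseteq> Z" "emeasure ?M Z = 0" "Z \<in> sets ?M"
    using AE by (rule AE_E)
  have "(S \<inter> ball x r) \<times> (I \<inter> ball t s) \<subseteq> {z \<in> space ?M. \<not> (case z of (x, t) \<Rightarrow> f x t = 0)}"
  proof (rule subsetI)
    fix z assume "z \<in> (S \<inter> ball x r) \<times> (I \<inter> ball t s)"
    then obtain y u where z: "z = (y, u)" and y: "y \<in> S" "y \<in> ball x r" and u: "u \<in> I" "u \<in> ball t s"
      by blast
    then have "(y, u) \<in> X \<times> T" using subsetD[OF r(2)] subsetD[OF s(2)] by simp
    from subsetD[OF XT(5) this] have "f y u \<noteq> 0" by simp
    then show "z \<in> {z \<in> space ?M. \<not> (case z of (x, t) \<Rightarrow> f x t = 0)}" using y u by (simp add: D z)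
  qed
  then have "emeasure ?M ((S \<inter> ball x r) \<times> (I \<inter> ball t s)) \<le> emeasure ?M Z"
    using Z by (intro emeasure_mono) auto
  then show False using pos Z by simp
qed

lemma emeasure_lborel_open_pos:
  fixes x :: "'a::euclidean_space"
  assumes "open W" "x \<in> W" "W \<subseteq> A" "A \<in> sets borel" "0 < r"
  shows "0 < emeasure lborel (A \<inter> ball x r)"
proof -
  have "open (W \<inter> ball x r)" "x \<in> W \<inter> ball x r" using assms by auto
  then obtain e where e: "0 < e" "ball x e \<subseteq> W \<inter> ball x r" using open_contains_ball by blast
  have "0 < emeasure lborel (ball x e)"
    using content_ball_pos[OF e(1), of x] emeasure_lborel_ball_finite[of x e]
    by (simp add: emeasure_eq_ennreal_measure)
  also have "\<dots> \<le> emeasure lborel (A \<inter> ball x r)"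
    using e assms by (intro emeasure_mono) auto
  finally show ?thesis .
qed

section \<open>Finite dimension of the trial space\<close>

lemma poly_fields_finite_span:
  obtains B where "finite B" "poly_fields k \<subseteq> span B"
proof
  let ?b = "\<lambda>(\<alpha>, j) x t. mon \<alpha> x t *\<^sub>R (axis j 1 :: real^3)"
  let ?B = "?b ` (exponents_le k \<times> UNIV)"
  show "finite ?B" by (simp add: finite_exponents_le)
  show "poly_fields k \<subseteq> span ?B"
  proof
    fix v assume v: "v \<in> poly_fields k"
    have "\<forall>j. \<exists>a. (\<lambda>x t. v x t $ j) = (\<lambda>x t. \<Sum>\<alpha>\<in>exponents_le k. a \<alpha> * mon \<alpha> x t)"
      using poly_fieldsD[OF v] unfolding poly_space_iff by blast
    then obtain a where a: "\<And>j. (\<lambda>x t. v x t $ j) = (\<lambda>x t. \<Sum>\<alpha>\<in>exponents_le k. a j \<alpha> * mon \<alpha> x t)"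
      by metis
    have a': "v x t $ j = (\<Sum>\<alpha>\<in>exponents_le k. a j \<alpha> * mon \<alpha> x t)" for x t j
      using fun_cong[OF fun_cong[OF a[of j]]] .
    have "v = (\<Sum>\<alpha>\<in>exponents_le k. \<Sum>j\<in>UNIV. a j \<alpha> *\<^sub>R ?b (\<alpha>, j))"
    proof (intro ext)
      fix x t
      show "v x t = (\<Sum>\<alpha>\<in>exponents_le k. \<Sum>j\<in>UNIV. a j \<alpha> *\<^sub>R ?b (\<alpha>, j)) x t"
        by (simp add: vec_eq_iff sum_fun_apply a' axis_def if_distrib cong: if_cong)
    qed
    also have "\<dots> \<in> span ?B"
      by (intro span_sum span_scale span_base) auto
    finally show "v \<in> span ?B" .
  qed
qed

lemma subspace_div_free: "subspace (div_free_poly_space k \<Omega> I)"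
proof -
  have eq: "div_free_poly_space k \<Omega> I = {v \<in> poly_fields k. \<forall>x\<in>\<Omega>. \<forall>t\<in>I. divergence v x t = 0}"
    by (auto simp: div_free_poly_space_def poly_fields_def)
  have "divergence 0 x t = 0" for x t
    using divergence_scaleR[OF subspace_0[OF subspace_poly_fields], of 0 x t] by (simp only: scaleR_zero_left mult_zero_left)
  then show ?thesis unfolding eq
    by (auto intro!: subspaceI simp: divergence_add divergence_scaleR
        subspace_0[OF subspace_poly_fields] subspace_add[OF subspace_poly_fields] subspace_scale[OF subspace_poly_fields])
qed

lemma div_free_poly_fields: "div_free_poly_space k \<Omega> I \<subseteq> poly_fields k"
  by (auto simp: div_free_poly_space_def poly_fields_def)

lemma Times_finite_span:
  assumes "finite B" "V \<subseteq> span B"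
  shows "\<exists>T. finite T \<and> V \<times> V \<subseteq> span T"
proof (intro exI conjI)
  let ?l = "\<lambda>b. (b, 0)" and ?r = "\<lambda>b. (0, b)"
  have l: "linear ?l" and r: "linear ?r" by (auto intro!: linearI)
  show "finite (?l ` B \<union> ?r ` B)" using assms by simp
  show "V \<times> V \<subseteq> span (?l ` B \<union> ?r ` B)"
  proof
    fix D assume "D \<in> V \<times> V"
    then obtain u w where D: "D = (u, w)" "u \<in> span B" "w \<in> span B" using assms by auto
    have "?l u \<in> span (?l ` B)" "?r w \<in> span (?r ` B)"
      using D unfolding linear_span_image[OF l] linear_span_image[OF r] by auto
    then have "?l u \<in> span (?l ` B \<union> ?r ` B)" "?r w \<in> span (?l ` B \<union> ?r ` B)"
      by (blast intro: subsetD[OF span_mono[OF Un_upper1]] subsetD[OF span_mono[OF Un_upper2]])+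
    then have "?l u + ?r w \<in> span (?l ` B \<union> ?r ` B)" by (rule span_add)
    then show "D \<in> span (?l ` B \<union> ?r ` B)" by (simp add: D)
  qed
qed

section \<open>Definiteness on the patch\<close>

lemma cube_eq_cbox: "cube c l = cbox (c - (\<chi> i. l / 2)) (c + (\<chi> i. l / 2))"
proof -
  have "\<bar>a - b\<bar> \<le> l / 2 \<longleftrightarrow> b - l / 2 \<le> a \<and> a \<le> b + l / 2" for a b :: real
    by linarith
  then show ?thesis by (simp add: cube_def mem_box_cart set_eq_iff)
qed

lemma ball_subset_cube: "ball c (l / 2) \<subseteq> cube c l"
proof
  fix x assume "x \<in> ball c (l / 2)"
  then have "norm (x - c) < l / 2" by (simp add: dist_norm norm_minus_commute)
  then have "\<bar>x $ i - c $ i\<bar> \<le> l / 2" for i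
    using component_le_norm_cart[of "x - c" i] by simp
  then show "x \<in> cube c l" by (simp add: cube_def)
qed

lemma AE_eq_0_if_square_integral_eq_0:
  fixes f :: "real^3 \<Rightarrow> real \<Rightarrow> 'b::euclidean_space"
  assumes "sq_integrable M (\<lambda>(x, t). f x t)" "(\<integral>(x, t). f x t \<bullet> f x t \<partial>M) = 0"
  shows "AE (x, t) in M. f x t = 0"
  using square_integral_eq_0_AE[OF assms(1)] assms(2) by (simp add: split_def)

lemma square_integral_nonneg: "0 \<le> (\<integral>(x, t). f x t \<bullet> f x t \<partial>M)"
  by (intro integral_nonneg_AE) (simp add: split_def)

lemma interior_emeasure_pos:
  fixes a b :: real
  assumes "a < t" "t < b" "0 < r"
  shows "0 < emeasure lborel ({a..b} \<inter> ball t r)"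
  by (rule emeasure_lborel_open_pos[of "{a<..<b}"]) (use assms in auto)

text \<open>Passes from the closed cube and closed interval to the ball \<open>?W\<close> and the
  open interval \<open>?T\<close>, where almost everywhere becomes everywhere and differentiation is
  possible. Since \<open>c\<close> is both the centre of the cube and a point of the surface,
  \<open>?W\<close> still meets the surface.\<close>

lemma poly_fields_eq_0_if_residuals_AE_0:
  fixes H E :: vector_field
  assumes \<mu>\<epsilon>: "\<mu> \<noteq> 0" "\<epsilon> \<noteq> 0" and l: "0 < l" and I: "a < b"
    and \<Gamma>: "C1_surface \<Gamma>" and c: "c \<in> \<Gamma>"
    and n: "\<And>x. x \<in> \<Gamma> \<Longrightarrow> norm (n x) = 1"
    and PV: "finite_patch lborel (cube c l) {a..b}"
    and PS: "finite_patch surface_area (cube c l \<inter> \<Gamma>) {a..b}"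
    and H: "H \<in> div_free_poly_space k (cube c l) {a..b}"
    and E: "E \<in> div_free_poly_space k (cube c l) {a..b}"
    and F: "AE (x, t) in spacetime_measure lborel (cube c l) {a..b}. \<mu> *\<^sub>R time_deriv H x t + curl E x t = 0"
    and G: "AE (x, t) in spacetime_measure lborel (cube c l) {a..b}. \<epsilon> *\<^sub>R time_deriv E x t - curl H x t = 0"
    and tH: "AE (x, t) in spacetime_measure surface_area (cube c l \<inter> \<Gamma>) {a..b}. cross3 (n x) (H x t) = 0"
    and nH: "AE (x, t) in spacetime_measure surface_area (cube c l \<inter> \<Gamma>) {a..b}. n x \<bullet> H x t = 0"
    and tE: "AE (x, t) in spacetime_measure surface_area (cube c l \<inter> \<Gamma>) {a..b}. cross3 (n x) (E x t) = 0"
    and nE: "AE (x, t) in spacetime_measure surface_area (cube c l \<inter> \<Gamma>) {a..b}. n x \<bullet> E x t = 0"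
  shows "H = 0 \<and> E = 0"
proof -
  let ?\<Omega> = "cube c l" and ?W = "ball c (l / 2)" and ?T = "{a<..<b}"
  have Hp: "H \<in> poly_fields k" and Ep: "E \<in> poly_fields k"
    using H E div_free_poly_fields by blast+
  have \<Omega>: "?\<Omega> \<in> sets borel" by (simp add: cube_eq_cbox)
  have W: "?W \<subseteq> ?\<Omega>" by (rule ball_subset_cube)
  have T: "?T \<subseteq> {a..b}" by auto
  have Fp: "\<mu> *\<^sub>R pdv None H + curl E \<in> poly_fields (k - 1)"
    and Gp: "\<epsilon> *\<^sub>R pdv None E - curl H \<in> poly_fields (k - 1)"
    by (intro subspace_add[OF subspace_poly_fields] subspace_diff[OF subspace_poly_fields]
        subspace_scale[OF subspace_poly_fields] pdv_in_poly_fields curl_in_poly_fields Hp Ep)+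
  have vol: "f x t = 0"
    if "f \<in> poly_fields (k - 1)" "AE (x, t) in spacetime_measure lborel ?\<Omega> {a..b}. f x t = 0"
      and x: "x \<in> ?W" and t: "t \<in> ?T" for f x t
  proof (rule continuous_eq_0_if_AE[OF PV poly_field_continuous[OF that(1)] that(2)])
    show "0 < emeasure lborel (?\<Omega> \<inter> ball x r)" if "0 < r" for r
      using emeasure_lborel_open_pos[OF open_ball x W \<Omega> \<open>0 < r\<close>] .
    show "0 < emeasure lborel ({a..b} \<inter> ball t r)" if "0 < r" for r
      using interior_emeasure_pos[of a t b r] that t by simp
  qed
  have F': "AE (x, t) in spacetime_measure lborel ?\<Omega> {a..b}. (\<mu> *\<^sub>R pdv None H + curl E) x t = 0"
    and G': "AE (x, t) in spacetime_measure lborel ?\<Omega> {a..b}. (\<epsilon> *\<^sub>R pdv None E - curl H) x t = 0"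
    using F G unfolding time_deriv_eq_pdv[OF Hp] time_deriv_eq_pdv[OF Ep]
    by (simp_all only: plus_fun_apply minus_apply scaleR_fun_apply)
  have "maxwell_on \<mu> \<epsilon> ?W ?T H E"
    unfolding maxwell_on_def
  proof (intro ballI conjI)
    fix x t assume x: "x \<in> ?W" and t: "t \<in> ?T"
    then have "x \<in> ?\<Omega>" "t \<in> {a..b}" using W T by blast+
    then show "divergence H x t = 0" "divergence E x t = 0"
      using H E unfolding div_free_poly_space_def by blast+
    show "\<mu> *\<^sub>R time_deriv H x t + curl E x t = 0"
      using vol[OF Fp F' x t] by (simp add: time_deriv_eq_pdv[OF Hp])
    show "\<epsilon> *\<^sub>R time_deriv E x t - curl H x t = 0"
      using vol[OF Gp G' x t] by (simp add: time_deriv_eq_pdv[OF Ep])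
  qed
  moreover have surf: "v x t = 0"
    if v: "v \<in> poly_fields k" and x: "x \<in> \<Gamma>" "x \<in> ?W" and t: "t \<in> ?T"
      and tv: "AE (x, t) in spacetime_measure surface_area (?\<Omega> \<inter> \<Gamma>) {a..b}. cross3 (n x) (v x t) = 0"
      and nv: "AE (x, t) in spacetime_measure surface_area (?\<Omega> \<inter> \<Gamma>) {a..b}. n x \<bullet> v x t = 0"
    for v x t
  proof (rule continuous_eq_0_if_AE[OF PS poly_field_continuous[OF v]])
    \<comment> \<open>Tangential and normal parts are combined before passing to pointwise
      statements: \<open>v\<close> is continuous everywhere, while \<open>n\<close> is controlled
      only on the surface.\<close>
    show "AE (x, t) in spacetime_measure surface_area (?\<Omega> \<inter> \<Gamma>) {a..b}. v x t = 0"
      using tv nv AE_space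
    proof eventually_elim
      case (elim z)
      obtain y s where z: "z = (y, s)" by (cases z)
      have "norm (n y) = 1" using elim n by (simp add: z finite_patchD[OF PS])
      then have "n y \<noteq> 0" by auto
      then show ?case using eq_0_if_cross_and_inner_eq_0[of "n y" "v y s"] elim by (simp add: z)
    qed
    show "0 < emeasure lborel ({a..b} \<inter> ball t r)" if "0 < r" for r
      using t that by (intro interior_emeasure_pos) auto
    show "0 < emeasure surface_area (?\<Omega> \<inter> \<Gamma> \<inter> ball x r)" if r: "0 < r" for r
    proof -
      have "open (?W \<inter> ball x r)" "x \<in> ?W \<inter> ball x r" using x r by auto
      then obtain e where e: "0 < e" "ball x e \<subseteq> ?W \<inter> ball x r" using open_contains_ball by blast
      have "0 < emeasure surface_area (\<Gamma> \<inter> ball x e)"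
        \<comment> \<open>A ball around \<open>x\<close> inside \<open>?W\<close> lies in the cube,
          so intersecting with the cube loses no area of this piece.\<close>
        by (rule C1_surface_area_pos[OF \<Gamma> x(1) e(1)])
      also have "\<dots> \<le> emeasure surface_area (?\<Omega> \<inter> \<Gamma> \<inter> ball x r)"
        using e W \<Omega> C1_surface_borel[OF \<Gamma>] by (intro emeasure_mono) auto
      finally show ?thesis .
    qed
  qed
  moreover have "c \<in> ?W" "(a + b) / 2 \<in> ?T" using l I by auto
  ultimately have "H x t = 0 \<and> E x t = 0" for x t
    using maxwell_unique_continuation[OF \<mu>\<epsilon> \<Gamma> open_ball open_greaterThanLessThan c _ _ Hp Ep]
      surf[OF Hp _ _ _ tH nH] surf[OF Ep _ _ _ tE nE] by blast
  then show ?thesis by (intro conjI ext) simp_all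
qed

section \<open>The correction functional\<close>

theorem proposition3p1:
  fixes \<mu> \<epsilon> l t\<^sub>n \<Delta>t :: real
    and \<Gamma> :: "(real^3) set" and n :: "real^3 \<Rightarrow> real^3" and c :: "real^3"
    and J\<^sub>s :: vector_field and \<rho>\<^sub>s :: scalar_field and k :: nat
  defines "\<Omega> \<equiv> cube c l" and "I \<equiv> {t\<^sub>n - \<Delta>t .. t\<^sub>n}"
  defines "V \<equiv> div_free_poly_space k \<Omega> I"
  defines "W \<equiv> V"
  assumes "\<mu> > 0" and "\<epsilon> > 0" and "l > 0" and "\<Delta>t > 0"
    and "C1_surface \<Gamma>" and "unit_normal_field \<Gamma> n" and "c \<in> \<Gamma>"
    and "0 < emeasure surface_area (\<Omega> \<inter> \<Gamma>)" and "emeasure surface_area (\<Omega> \<inter> \<Gamma>) < \<infinity>"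
    and "square_integrable_surf (\<Omega> \<inter> \<Gamma>) I J\<^sub>s" and "square_integrable_surf (\<Omega> \<inter> \<Gamma>) I \<rho>\<^sub>s"
  shows "\<exists>c\<^sub>t c\<^sub>p. c\<^sub>t > 0 \<and> c\<^sub>p > 0 \<and> c\<^sub>t = c\<^sub>p / l \<and>
           (\<exists>!D. D \<in> V \<times> W \<and>
              (\<forall>D'\<in>V \<times> W. functional_J \<mu> \<epsilon> l \<Omega> I \<Gamma> n J\<^sub>s \<rho>\<^sub>s c\<^sub>p D
                         \<le> functional_J \<mu> \<epsilon> l \<Omega> I \<Gamma> n J\<^sub>s \<rho>\<^sub>s c\<^sub>p D'))"
proof -
  let ?S = "\<Omega> \<inter> \<Gamma>"
  let ?MV = "spacetime_measure lborel \<Omega> I" and ?MS = "spacetime_measure surface_area (\<Omega> \<inter> \<Gamma>) I"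
  have \<Omega>: "compact \<Omega>" unfolding \<Omega>_def cube_eq_cbox by (rule compact_cbox)
  have PV: "finite_patch lborel \<Omega> I"
    using emeasure_compact_finite[OF \<Omega>] \<Omega> by (simp add: finite_patch_def borel_compact I_def)
  have PS: "finite_patch surface_area ?S I"
    using assms(13) C1_surface_borel[OF assms(9)] \<Omega>
    by (simp add: finite_patch_def borel_compact I_def sets.Int)
  have n1: "norm (n x) = 1" if "x \<in> \<Gamma>" for x
    using assms(10) that by (simp add: unit_normal_field_def)
  have nc: "continuous_on ?S n"
    using assms(10) by (auto simp: unit_normal_field_def intro: continuous_on_subset)
  have J: "sq_integrable ?MS (\<lambda>(x, t). J\<^sub>s x t)" and "sq_integrable ?MS (\<lambda>(x, t). \<rho>\<^sub>s x t)"
    using assms(14,15)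
    by (auto simp: square_integrable_surf_def sq_integrable_def spacetime_measure_def Let_def split_def)
  from sq_integrable_scaleR[OF this(2), of "1 / \<epsilon>"]
  have \<rho>: "sq_integrable ?MS (\<lambda>(x, t). \<rho>\<^sub>s x t / \<epsilon>)" by (simp add: split_def)
  have zero: "sq_integrable M (\<lambda>(x, t). 0)" for M :: "((real^3) \<times> real) measure"
    by (simp add: sq_integrable_def split_def)
  have V: "subspace (V \<times> V)" unfolding V_def by (intro subspace_Times subspace_div_free)
  obtain B where "finite B" "poly_fields k \<subseteq> span B" by (rule poly_fields_finite_span)
  then obtain T where T: "finite T" "V \<times> V \<subseteq> span T"
    using Times_finite_span[of B V] div_free_poly_fields unfolding V_def by blast
  have p: "fst D \<in> poly_fields k" "snd D \<in> poly_fields k" if "D \<in> V \<times> V" for D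
    using that subsetD[OF div_free_poly_fields] unfolding V_def by auto
  note td = time_deriv_eq_pdv
  have vol: "sq_integrable ?MV (\<lambda>(x, t). v x t)" if "v \<in> poly_fields (k - 1)" for v
    by (rule sq_integrable_continuous[OF PV subset_refl \<Omega> poly_field_continuous[OF that]])
  define F where "F D x t = \<mu> *\<^sub>R time_deriv (fst D) x t + curl (snd D) x t"
    for D :: "vector_field \<times> vector_field" and x t
  define G where "G D x t = \<epsilon> *\<^sub>R time_deriv (snd D) x t - curl (fst D) x t"
    for D :: "vector_field \<times> vector_field" and x t
  have sF: "sq_integrable ?MV (\<lambda>(x, t). F D x t)" and sG: "sq_integrable ?MV (\<lambda>(x, t). G D x t)"
    if D: "D \<in> V \<times> V" for D
  proof -
    have "\<mu> *\<^sub>R pdv None (fst D) + curl (snd D) \<in> poly_fields (k - 1)"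
      "\<epsilon> *\<^sub>R pdv None (snd D) - curl (fst D) \<in> poly_fields (k - 1)"
      by (intro subspace_add[OF subspace_poly_fields] subspace_diff[OF subspace_poly_fields]
          subspace_scale[OF subspace_poly_fields] pdv_in_poly_fields curl_in_poly_fields p D)+
    from vol[OF this(1)] vol[OF this(2)]
    show "sq_integrable ?MV (\<lambda>(x, t). F D x t)" "sq_integrable ?MV (\<lambda>(x, t). G D x t)"
      by (simp_all add: F_def G_def td[OF p(1)[OF D]] td[OF p(2)[OF D]])
  qed
  have lin_add: "F (D + D') x t = F D x t + F D' x t" "G (D + D') x t = G D x t + G D' x t"
    if D: "D \<in> V \<times> V" "D' \<in> V \<times> V" for D D' x t
    unfolding F_def G_def fst_add snd_add
      td[OF p(1)[OF subspace_add[OF V D]], unfolded fst_add] td[OF p(2)[OF subspace_add[OF V D]], unfolded snd_add]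
      td[OF p(1)[OF D(1)]] td[OF p(1)[OF D(2)]] td[OF p(2)[OF D(1)]] td[OF p(2)[OF D(2)]]
      pdv_add[OF p(1)[OF D(1)] p(1)[OF D(2)]] pdv_add[OF p(2)[OF D(1)] p(2)[OF D(2)]]
      curl_add[OF p(1)[OF D(1)] p(1)[OF D(2)]] curl_add[OF p(2)[OF D(1)] p(2)[OF D(2)]]
    by (simp_all add: algebra_simps)
  have lin_scale: "F (r *\<^sub>R D) x t = r *\<^sub>R F D x t" "G (r *\<^sub>R D) x t = r *\<^sub>R G D x t"
    if D: "D \<in> V \<times> V" for D r x t
    using td[OF p(1)[OF subspace_scale[OF V D]]] td[OF p(2)[OF subspace_scale[OF V D]]]
    by (simp_all add: F_def G_def td[OF p(1)[OF D]] td[OF p(2)[OF D]]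
        pdv_scaleR[OF p(1)[OF D]] pdv_scaleR[OF p(2)[OF D]]
        curl_scaleR[OF p(1)[OF D]] curl_scaleR[OF p(2)[OF D]] algebra_simps)
  have normal: "sq_integrable ?MS (\<lambda>(x, t). cross3 (n x) (v x t))" "sq_integrable ?MS (\<lambda>(x, t). n x \<bullet> v x t)"
    if "v \<in> poly_fields k" for v
    using sq_integrable_normal_parts[OF PS _ \<Omega> nc _ that] n1 by auto
  \<comment> \<open>The bilinear form of the functional with the data set to zero; the weights
    \<open>1 / 2\<close> belong to the choice \<open>c\<^sub>p = 1\<close>.\<close>
  define a where "a D D' =
      l / 2 * (\<integral>(x, t). F D x t \<bullet> F D' x t \<partial>?MV) + l / 2 * (\<integral>(x, t). G D x t \<bullet> G D' x t \<partial>?MV)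
      + 1 / 2 * (\<integral>(x, t). cross3 (n x) (fst D x t) \<bullet> cross3 (n x) (fst D' x t) \<partial>?MS)
      + 1 / 2 * (\<integral>(x, t). (n x \<bullet> fst D x t) \<bullet> (n x \<bullet> fst D' x t) \<partial>?MS)
      + 1 / 2 * (\<integral>(x, t). cross3 (n x) (snd D x t) \<bullet> cross3 (n x) (snd D' x t) \<partial>?MS)
      + 1 / 2 * (\<integral>(x, t). (n x \<bullet> snd D x t) \<bullet> (n x \<bullet> snd D' x t) \<partial>?MS)" for D D'
  have nadd: "cross3 (n x) ((u + v) x t) = cross3 (n x) (u x t) + cross3 (n x) (v x t)"
    "n x \<bullet> (u + v) x t = n x \<bullet> u x t + n x \<bullet> v x t"
    and nscale: "cross3 (n x) ((r *\<^sub>R u) x t) = r *\<^sub>R cross3 (n x) (u x t)"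
    "n x \<bullet> (r *\<^sub>R u) x t = r *\<^sub>R (n x \<bullet> u x t)" for u v :: vector_field and r x t
    by (simp_all add: cross_add_right cross_mult_right inner_add_right)
  note qF = quadratic_on_iterated_integral[OF PV V, where A = F and b = "\<lambda>_ _. 0", OF sF zero lin_add(1) lin_scale(1)]
  note qG = quadratic_on_iterated_integral[OF PV V, where A = G and b = "\<lambda>_ _. 0", OF sG zero lin_add(2) lin_scale(2)]
  have qtH: "quadratic_on (V \<times> V) (\<lambda>D D'. \<integral>(x, t). cross3 (n x) (fst D x t) \<bullet> cross3 (n x) (fst D' x t) \<partial>?MS)
      (\<lambda>D. LINT t:I|lborel. (LINT x:?S|surface_area.
         (cross3 (n x) (fst D x t) - J\<^sub>s x t) \<bullet> (cross3 (n x) (fst D x t) - J\<^sub>s x t)))"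
    by (rule quadratic_on_iterated_integral[OF PS V normal(1)[OF p(1)] J])
      (simp_all only: fst_add fst_scaleR nadd nscale)
  \<comment> \<open>Subtracting 0 exhibits the homogeneous condition as an instance with zero data;
    \<open>diff_zero\<close> removes it when the terms are matched with the functional.\<close>
  have qnH: "quadratic_on (V \<times> V) (\<lambda>D D'. \<integral>(x, t). (n x \<bullet> fst D x t) \<bullet> (n x \<bullet> fst D' x t) \<partial>?MS)
      (\<lambda>D. LINT t:I|lborel. (LINT x:?S|surface_area. (n x \<bullet> fst D x t - 0) \<bullet> (n x \<bullet> fst D x t - 0)))"
    by (rule quadratic_on_iterated_integral[OF PS V normal(2)[OF p(1)] zero])
      (simp_all only: fst_add fst_scaleR nadd nscale)
  have qtE: "quadratic_on (V \<times> V) (\<lambda>D D'. \<integral>(x, t). cross3 (n x) (snd D x t) \<bullet> cross3 (n x) (snd D' x t) \<partial>?MS)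
      (\<lambda>D. LINT t:I|lborel. (LINT x:?S|surface_area.
         (cross3 (n x) (snd D x t) - 0) \<bullet> (cross3 (n x) (snd D x t) - 0)))"
    by (rule quadratic_on_iterated_integral[OF PS V normal(1)[OF p(2)] zero])
      (simp_all only: snd_add snd_scaleR nadd nscale)
  have qnE: "quadratic_on (V \<times> V) (\<lambda>D D'. \<integral>(x, t). (n x \<bullet> snd D x t) \<bullet> (n x \<bullet> snd D' x t) \<partial>?MS)
      (\<lambda>D. LINT t:I|lborel. (LINT x:?S|surface_area.
         (n x \<bullet> snd D x t - \<rho>\<^sub>s x t / \<epsilon>) \<bullet> (n x \<bullet> snd D x t - \<rho>\<^sub>s x t / \<epsilon>)))"
    by (rule quadratic_on_iterated_integral[OF PS V normal(2)[OF p(2)] \<rho>])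
      (simp_all only: snd_add snd_scaleR nadd nscale)
  have l2: "0 \<le> l / 2" "l / 2 \<noteq> 0" and half: "(0::real) \<le> 1 / 2" using assms(7) by auto
  note sum = quadratic_on_add[OF quadratic_on_add[OF quadratic_on_add[OF quadratic_on_add[OF quadratic_on_add[OF
    quadratic_on_scale[OF qF l2(1)] quadratic_on_scale[OF qG l2(1)]]
    quadratic_on_scale[OF qtH half]] quadratic_on_scale[OF qnH half]]
    quadratic_on_scale[OF qtE half]] quadratic_on_scale[OF qnE half]]
  have Q: "quadratic_on (V \<times> V) a (functional_J \<mu> \<epsilon> l \<Omega> I \<Gamma> n J\<^sub>s \<rho>\<^sub>s 1)"
    unfolding a_def
    by (rule quadratic_on_cong[OF sum], assumption+)
      (simp only: functional_J_def split_def Let_def inner_vol_def inner_surf_def F_def G_def diff_zero)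
  have definite: "D = 0" if D: "D \<in> V \<times> V" and aD: "a D D = 0" for D
  proof -
    note nonneg = square_integral_nonneg[of ?MV "F D"] square_integral_nonneg[of ?MV "G D"]
      square_integral_nonneg[of ?MS "\<lambda>x t. cross3 (n x) (fst D x t)"]
      square_integral_nonneg[of ?MS "\<lambda>x t. n x \<bullet> fst D x t"]
      square_integral_nonneg[of ?MS "\<lambda>x t. cross3 (n x) (snd D x t)"]
      square_integral_nonneg[of ?MS "\<lambda>x t. n x \<bullet> snd D x t"]
    \<comment> \<open>The factor \<open>l / 2\<close> is not a numeral, so linear arithmetic sees
      these products as atoms and needs their signs directly.\<close>
    note nonneg' = mult_nonneg_nonneg[OF l2(1) nonneg(1)] mult_nonneg_nonneg[OF l2(1) nonneg(2)]
    have "l / 2 * (\<integral>(x, t). F D x t \<bullet> F D x t \<partial>?MV) = 0" "l / 2 * (\<integral>(x, t). G D x t \<bullet> G D x t \<partial>?MV) = 0"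
      and z: "(\<integral>(x, t). cross3 (n x) (fst D x t) \<bullet> cross3 (n x) (fst D x t) \<partial>?MS) = 0"
      "(\<integral>(x, t). (n x \<bullet> fst D x t) \<bullet> (n x \<bullet> fst D x t) \<partial>?MS) = 0"
      "(\<integral>(x, t). cross3 (n x) (snd D x t) \<bullet> cross3 (n x) (snd D x t) \<partial>?MS) = 0"
      "(\<integral>(x, t). (n x \<bullet> snd D x t) \<bullet> (n x \<bullet> snd D x t) \<partial>?MS) = 0"
      using nonneg(3-6) nonneg' aD unfolding a_def by linarith+
    then have "(\<integral>(x, t). F D x t \<bullet> F D x t \<partial>?MV) = 0" "(\<integral>(x, t). G D x t \<bullet> G D x t \<partial>?MV) = 0"
      using l2(2) mult_eq_0_iff by blast+
    note AE0 = AE_eq_0_if_square_integral_eq_0[OF sF[OF D] this(1)]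
      AE_eq_0_if_square_integral_eq_0[OF sG[OF D] this(2)]
      AE_eq_0_if_square_integral_eq_0[OF normal(1)[OF p(1)[OF D]] z(1)]
      AE_eq_0_if_square_integral_eq_0[OF normal(2)[OF p(1)[OF D]] z(2)]
      AE_eq_0_if_square_integral_eq_0[OF normal(1)[OF p(2)[OF D]] z(3)]
      AE_eq_0_if_square_integral_eq_0[OF normal(2)[OF p(2)[OF D]] z(4)]
    have "fst D = 0 \<and> snd D = 0"
    proof (rule poly_fields_eq_0_if_residuals_AE_0[where a = "t\<^sub>n - \<Delta>t" and b = t\<^sub>n])
      show "fst D \<in> div_free_poly_space k (cube c l) {t\<^sub>n - \<Delta>t..t\<^sub>n}"
        "snd D \<in> div_free_poly_space k (cube c l) {t\<^sub>n - \<Delta>t..t\<^sub>n}"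
        using D by (auto simp: V_def \<Omega>_def I_def)
    qed (use assms(5-9,11) n1 PV[unfolded \<Omega>_def I_def] PS[unfolded \<Omega>_def I_def]
        AE0[unfolded \<Omega>_def I_def F_def G_def] in auto)
    then show "D = 0" by (simp add: prod_eq_iff)
  qed
  have "\<exists>!D. D \<in> V \<times> W \<and> (\<forall>D'\<in>V \<times> W. functional_J \<mu> \<epsilon> l \<Omega> I \<Gamma> n J\<^sub>s \<rho>\<^sub>s 1 D
                         \<le> functional_J \<mu> \<epsilon> l \<Omega> I \<Gamma> n J\<^sub>s \<rho>\<^sub>s 1 D')"
    unfolding W_def by (rule quadratic_on_ex1_minimizer[OF V T Q definite])
  \<comment> \<open>The penalty weight is \<open>c\<^sub>p = 1\<close>, so the ratio
    \<open>c\<^sub>t\<close> is \<open>1 / l\<close>.\<close>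
  then show ?thesis
    using assms(7) by (intro exI[of _ "1 / l"] exI[of _ 1] conjI) auto
qed

end
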